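(* Let $(R,\mathfrak{m})$ be a commutative Noetherian local ring, let $\mathfrak{a}$ and $J$ be ideals of $R$, and let $M$ be a non-zero finitely generated $R$-module. Then $\mathrm{CoSupp}(\mathfrak{F}^i_{\mathfrak{a},\mathfrak{m},J}(M))\subseteq V(\mathfrak{a})$ for all integers $i$.
   Context: For ideals $I,J$ and an $R$-module $N$, $\Gamma_{I,J}(N)=\{x\in N : I^n x\subseteq Jx \text{ for all } n\gg 0\}$, and $H^i_{I,J}$ is the $i$th right derived functor of $\Gamma_{I,J}$. Set $\mathfrak{F}^i_{\mathfrak{a},I,J}(M):=\varprojlim_n H^i_{I,J}(M/\mathfrak{a}^nM)$; here $I=\mathfrak{m}$. The cosupport of an $R$-module $N$ is $\mathrm{CoSupp}(N)=\{\mathfrak{p}\in\mathrm{Spec}\,R : \mathrm{Hom}_R(R_{\mathfrak{p}},N)\neq 0\}$. *)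

theory Defs
  imports "HOL-Algebra.Ring_Divisibility" "HOL-Algebra.Ideal_Product" "HOL-Algebra.Module"
begin

section \<open>Rings and ideals\<close>

definition local_ring :: "('r, 'x) ring_scheme \<Rightarrow> 'r set \<Rightarrow> bool" where
  "local_ring R \<mm> \<longleftrightarrow>
     cring R \<and> maximalideal \<mm> R \<and> (\<forall>\<nn>. maximalideal \<nn> R \<longrightarrow> \<nn> = \<mm>)"

definition Spec :: "('r, 'x) ring_scheme \<Rightarrow> 'r set set" where
  "Spec R = {\<pp>. primeideal \<pp> R}"

definition V :: "('r, 'x) ring_scheme \<Rightarrow> 'r set \<Rightarrow> 'r set set" where
  "V R \<aa> = {\<pp> \<in> Spec R. \<aa> \<subseteq> \<pp>}"

text \<open>The power in the monoid of ideals; in particular the zeroth power is the whole ring.\<close>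

abbreviation ideal_power :: "('r, 'x) ring_scheme \<Rightarrow> 'r set \<Rightarrow> nat \<Rightarrow> 'r set" where
  "ideal_power R I n \<equiv> I [^]\<^bsub>ideals_set R\<^esub> n"


section \<open>Modules\<close>

definition submodule_span ::
    "('r, 'x) ring_scheme \<Rightarrow> ('r, 'm, 'y) module_scheme \<Rightarrow> 'm set \<Rightarrow> 'm set" where
  "submodule_span R M S = \<Inter>{H. submodule H R M \<and> S \<subseteq> H}"

definition finitely_generated_module ::
    "('r, 'x) ring_scheme \<Rightarrow> ('r, 'm, 'y) module_scheme \<Rightarrow> bool" where
  "finitely_generated_module R M \<longleftrightarrow>
     (\<exists>S. finite S \<and> S \<subseteq> carrier M \<and> submodule_span R M S = carrier M)"

definition ideal_times_module ::
    "('r, 'x) ring_scheme \<Rightarrow> 'r set \<Rightarrow> ('r, 'm, 'y) module_scheme \<Rightarrow> 'm set" where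
  "ideal_times_module R I M = submodule_span R M {r \<odot>\<^bsub>M\<^esub> x |r x. r \<in> I \<and> x \<in> carrier M}"

text \<open>
  Linear maps are taken to be extensional, so that the zero map on the carrier is one
  function and the Hom set vanishes exactly when it contains nothing else.
\<close>

definition mod_Hom ::
    "('r, 'x) ring_scheme \<Rightarrow> ('r, 'a, 'y) module_scheme \<Rightarrow> ('r, 'b, 'z) module_scheme
       \<Rightarrow> ('a \<Rightarrow> 'b) set" where
  "mod_Hom R A B =
     {f \<in> carrier A \<rightarrow>\<^sub>E carrier B.
        (\<forall>x\<in>carrier A. \<forall>y\<in>carrier A. f (x \<oplus>\<^bsub>A\<^esub> y) = f x \<oplus>\<^bsub>B\<^esub> f y) \<and>
        (\<forall>r\<in>carrier R. \<forall>x\<in>carrier A. f (r \<odot>\<^bsub>A\<^esub> x) = r \<odot>\<^bsub>B\<^esub> f x)}"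

text \<open>
  The record of a module extends the record of a ring. The ring fields \<open>mult\<close> and \<open>one\<close>
  play no role for a module and are left unspecified below.
\<close>

definition quot_module ::
    "('r, 'm, 'y) module_scheme \<Rightarrow> 'm set \<Rightarrow> ('r, 'm set) module" where
  "quot_module M N =
     \<lparr>carrier = a_rcosets\<^bsub>M\<^esub> N, monoid.mult = undefined, one = undefined,
      zero = N, add = set_add M,
      smult = (\<lambda>r C. \<Union>x\<in>C. N +>\<^bsub>M\<^esub> (r \<odot>\<^bsub>M\<^esub> x))\<rparr>"

text \<open>
  The map into the quotient of \<open>M'\<close> by \<open>N'\<close> induced on cosets by \<open>f\<close>. If \<open>f\<close> carries the
  submodule of the source into \<open>N'\<close>, then all members of the union are equal.
\<close>

definition quot_map ::
    "('r, 'b, 'y) module_scheme \<Rightarrow> 'b set \<Rightarrow> ('a \<Rightarrow> 'b) \<Rightarrow> 'a set \<Rightarrow> 'b set" where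
  "quot_map M' N' f C = (\<Union>x\<in>C. N' +>\<^bsub>M'\<^esub> f x)"

definition adic_quotient ::
    "('r, 'x) ring_scheme \<Rightarrow> 'r set \<Rightarrow> ('r, 'm, 'y) module_scheme \<Rightarrow> nat
       \<Rightarrow> ('r, 'm set) module" where
  "adic_quotient R \<aa> M n = quot_module M (ideal_times_module R (ideal_power R \<aa> n) M)"

definition adic_projection ::
    "('r, 'x) ring_scheme \<Rightarrow> 'r set \<Rightarrow> ('r, 'm, 'y) module_scheme \<Rightarrow> nat
       \<Rightarrow> 'm set \<Rightarrow> 'm set" where
  "adic_projection R \<aa> M n = quot_map M (ideal_times_module R (ideal_power R \<aa> n) M) (\<lambda>x. x)"

text \<open>The limit of \<open>\<dots> \<rightarrow> H 2 \<rightarrow> H 1 \<rightarrow> H 0\<close> along \<open>t n : H (Suc n) \<rightarrow> H n\<close>.\<close>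

definition inverse_limit ::
    "(nat \<Rightarrow> ('r, 'm, 'y) module_scheme) \<Rightarrow> (nat \<Rightarrow> 'm \<Rightarrow> 'm) \<Rightarrow> ('r, nat \<Rightarrow> 'm) module" where
  "inverse_limit H t =
     \<lparr>carrier = {x. (\<forall>n. x n \<in> carrier (H n)) \<and> (\<forall>n. t n (x (Suc n)) = x n)},
      monoid.mult = undefined, one = undefined,
      zero = (\<lambda>n. \<zero>\<^bsub>H n\<^esub>), add = (\<lambda>x y n. x n \<oplus>\<^bsub>H n\<^esub> y n),
      smult = (\<lambda>r x n. r \<odot>\<^bsub>H n\<^esub> x n)\<rparr>"


section \<open>Localization and cosupport\<close>

definition loc_rel ::
    "('r, 'x) ring_scheme \<Rightarrow> 'r set \<Rightarrow> (('r \<times> 'r) \<times> ('r \<times> 'r)) set" where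
  "loc_rel R S =
     {((r, s), (r', s')). r \<in> carrier R \<and> r' \<in> carrier R \<and> s \<in> S \<and> s' \<in> S \<and>
        (\<exists>u\<in>S. u \<otimes>\<^bsub>R\<^esub> (r \<otimes>\<^bsub>R\<^esub> s' \<ominus>\<^bsub>R\<^esub> r' \<otimes>\<^bsub>R\<^esub> s) = \<zero>\<^bsub>R\<^esub>)}"

definition loc_frac :: "('r, 'x) ring_scheme \<Rightarrow> 'r set \<Rightarrow> 'r \<Rightarrow> 'r \<Rightarrow> ('r \<times> 'r) set" where
  "loc_frac R S r s = loc_rel R S `` {(r, s)}"

text \<open>The ring of fractions with denominators in \<open>S\<close>, together with its module structure over \<open>R\<close>.\<close>

definition localization ::
    "('r, 'x) ring_scheme \<Rightarrow> 'r set \<Rightarrow> ('r, ('r \<times> 'r) set) module" where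
  "localization R S =
     \<lparr>carrier = (carrier R \<times> S) // loc_rel R S,
      monoid.mult = (\<lambda>X Y. \<Union>(r, s)\<in>X. \<Union>(r', s')\<in>Y. loc_frac R S (r \<otimes>\<^bsub>R\<^esub> r') (s \<otimes>\<^bsub>R\<^esub> s')),
      one = loc_frac R S \<one>\<^bsub>R\<^esub> \<one>\<^bsub>R\<^esub>,
      zero = loc_frac R S \<zero>\<^bsub>R\<^esub> \<one>\<^bsub>R\<^esub>,
      add = (\<lambda>X Y. \<Union>(r, s)\<in>X. \<Union>(r', s')\<in>Y.
               loc_frac R S (r \<otimes>\<^bsub>R\<^esub> s' \<oplus>\<^bsub>R\<^esub> r' \<otimes>\<^bsub>R\<^esub> s) (s \<otimes>\<^bsub>R\<^esub> s')),
      smult = (\<lambda>a X. \<Union>(r, s)\<in>X. loc_frac R S (a \<otimes>\<^bsub>R\<^esub> r) s)\<rparr>"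

definition CoSupp ::
    "('r, 'x) ring_scheme \<Rightarrow> ('r, 'm, 'y) module_scheme \<Rightarrow> 'r set set" where
  "CoSupp R N =
     {\<pp> \<in> Spec R. mod_Hom R (localization R (carrier R - \<pp>)) N
                    \<noteq> {\<lambda>x\<in>carrier (localization R (carrier R - \<pp>)). \<zero>\<^bsub>N\<^esub>}}"


section \<open>Injective resolutions\<close>

text \<open>
  HOL cannot quantify over all types inside a formula, so the modules against which
  injectivity is tested are carried by the type \<open>'r + 'e\<close>. This type contains a copy
  of \<open>R\<close> and of all its ideals, so by Baer's criterion the definition amounts to the
  lifting property against arbitrary modules.
\<close>

definition injective_module :: "('r, 'x) ring_scheme \<Rightarrow> ('r, 'e) module \<Rightarrow> bool" where
  "injective_module R E \<longleftrightarrow> module R E \<and>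
     (\<forall>(A :: ('r, 'r + 'e) module) (B :: ('r, 'r + 'e) module).
        module R A \<longrightarrow> module R B \<longrightarrow>
        (\<forall>j\<in>mod_Hom R A B. inj_on j (carrier A) \<longrightarrow>
          (\<forall>g\<in>mod_Hom R A E. \<exists>h\<in>mod_Hom R B E. \<forall>x\<in>carrier A. h (j x) = g x)))"

text \<open>
  Complexes are indexed by the integers; a resolution vanishes in negative degrees and
  \<open>0 \<rightarrow> N \<rightarrow> E 0 \<rightarrow> E 1 \<rightarrow> \<dots>\<close> is exact, with augmentation \<open>\<epsilon>\<close>.
\<close>

definition injective_resolution ::
    "('r, 'x) ring_scheme \<Rightarrow> ('r, 'm, 'y) module_scheme
       \<Rightarrow> (int \<Rightarrow> ('r, 'e) module) \<Rightarrow> (int \<Rightarrow> 'e \<Rightarrow> 'e) \<Rightarrow> ('m \<Rightarrow> 'e) \<Rightarrow> bool" where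
  "injective_resolution R N E d \<epsilon> \<longleftrightarrow>
     (\<forall>i. injective_module R (E i)) \<and>
     (\<forall>i<0. carrier (E i) = {\<zero>\<^bsub>E i\<^esub>}) \<and>
     (\<forall>i. d i \<in> mod_Hom R (E i) (E (i + 1))) \<and>
     \<epsilon> \<in> mod_Hom R N (E 0) \<and>
     inj_on \<epsilon> (carrier N) \<and>
     \<epsilon> ` carrier N = a_kernel (E 0) (E 1) (d 0) \<and>
     (\<forall>i\<ge>0. d i ` carrier (E i) = a_kernel (E (i + 1)) (E (i + 1 + 1)) (d (i + 1)))"

text \<open>\<open>\<phi>\<close> is a chain map between resolutions of \<open>N\<close> and \<open>N'\<close> that lifts \<open>f : N \<rightarrow> N'\<close>.\<close>

definition resolution_lift ::
    "('r, 'x) ring_scheme \<Rightarrow> ('r, 'm, 'y) module_scheme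
       \<Rightarrow> (int \<Rightarrow> ('r, 'e) module) \<Rightarrow> (int \<Rightarrow> 'e \<Rightarrow> 'e) \<Rightarrow> ('m \<Rightarrow> 'e)
       \<Rightarrow> (int \<Rightarrow> ('r, 'e) module) \<Rightarrow> (int \<Rightarrow> 'e \<Rightarrow> 'e) \<Rightarrow> ('n \<Rightarrow> 'e)
       \<Rightarrow> ('m \<Rightarrow> 'n) \<Rightarrow> (int \<Rightarrow> 'e \<Rightarrow> 'e) \<Rightarrow> bool" where
  "resolution_lift R N E d \<epsilon> E' d' \<epsilon>' f \<phi> \<longleftrightarrow>
     (\<forall>i. \<phi> i \<in> mod_Hom R (E i) (E' i)) \<and>
     (\<forall>i. \<forall>x\<in>carrier (E i). \<phi> (i + 1) (d i x) = d' i (\<phi> i x)) \<and>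
     (\<forall>x\<in>carrier N. \<phi> 0 (\<epsilon> x) = \<epsilon>' (f x))"


section \<open>Local cohomology with respect to a pair of ideals\<close>

definition pair_torsion ::
    "('r, 'x) ring_scheme \<Rightarrow> 'r set \<Rightarrow> 'r set \<Rightarrow> ('r, 'm) module \<Rightarrow> ('r, 'm) module" where
  "pair_torsion R I J N =
     N\<lparr>carrier := {x \<in> carrier N. \<exists>n\<^sub>0. \<forall>n\<ge>n\<^sub>0.
         (\<lambda>r. r \<odot>\<^bsub>N\<^esub> x) ` ideal_power R I n \<subseteq> (\<lambda>r. r \<odot>\<^bsub>N\<^esub> x) ` J}\<rparr>"

definition cocycles ::
    "(int \<Rightarrow> ('r, 'e) module) \<Rightarrow> (int \<Rightarrow> 'e \<Rightarrow> 'e) \<Rightarrow> int \<Rightarrow> ('r, 'e) module" where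
  "cocycles C d i = (C i)\<lparr>carrier := a_kernel (C i) (C (i + 1)) (d i)\<rparr>"

definition coboundaries ::
    "(int \<Rightarrow> ('r, 'e) module) \<Rightarrow> (int \<Rightarrow> 'e \<Rightarrow> 'e) \<Rightarrow> int \<Rightarrow> 'e set" where
  "coboundaries C d i = d (i - 1) ` carrier (C (i - 1))"

definition cohomology ::
    "(int \<Rightarrow> ('r, 'e) module) \<Rightarrow> (int \<Rightarrow> 'e \<Rightarrow> 'e) \<Rightarrow> int \<Rightarrow> ('r, 'e set) module" where
  "cohomology C d i = quot_module (cocycles C d i) (coboundaries C d i)"

text \<open>
  A right derived functor is determined only up to the choice of injective resolutions,
  and on morphisms up to the choice of lifts. These choices are arguments: \<open>(E, d)\<close> stands
  for an injective resolution of the module whose local cohomology is taken. On morphisms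
  the torsion functor is restriction, so a chain map needs no modification.
\<close>

definition local_cohomology ::
    "('r, 'x) ring_scheme \<Rightarrow> 'r set \<Rightarrow> 'r set
       \<Rightarrow> (int \<Rightarrow> ('r, 'e) module) \<Rightarrow> (int \<Rightarrow> 'e \<Rightarrow> 'e) \<Rightarrow> int \<Rightarrow> ('r, 'e set) module" where
  "local_cohomology R I J E d i = cohomology (\<lambda>k. pair_torsion R I J (E k)) d i"

text \<open>The map into the local cohomology computed by \<open>(E', d')\<close> induced by a chain map \<open>\<phi>\<close>.\<close>

definition local_cohomology_map ::
    "('r, 'x) ring_scheme \<Rightarrow> 'r set \<Rightarrow> 'r set
       \<Rightarrow> (int \<Rightarrow> ('r, 'e) module) \<Rightarrow> (int \<Rightarrow> 'e \<Rightarrow> 'e) \<Rightarrow> int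
       \<Rightarrow> (int \<Rightarrow> 'e \<Rightarrow> 'e) \<Rightarrow> 'e set \<Rightarrow> 'e set" where
  "local_cohomology_map R I J E' d' i \<phi> =
     quot_map (cocycles (\<lambda>k. pair_torsion R I J (E' k)) d' i)
              (coboundaries (\<lambda>k. pair_torsion R I J (E' k)) d' i) (\<phi> i)"

text \<open>
  The module \<open>M\<close> and the ideal \<open>\<aa>\<close> enter through the choices made: \<open>(E n, d n, \<epsilon> n)\<close> is an
  injective resolution of the \<open>n\<close>-th adic quotient of \<open>M\<close>, and \<open>\<phi> n\<close> lifts the projection
  from the \<open>Suc n\<close>-th to the \<open>n\<close>-th quotient.
\<close>

definition adic_resolution_system ::
    "('r, 'x) ring_scheme \<Rightarrow> 'r set \<Rightarrow> ('r, 'm, 'y) module_scheme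
       \<Rightarrow> (nat \<Rightarrow> int \<Rightarrow> ('r, 'e) module) \<Rightarrow> (nat \<Rightarrow> int \<Rightarrow> 'e \<Rightarrow> 'e)
       \<Rightarrow> (nat \<Rightarrow> 'm set \<Rightarrow> 'e) \<Rightarrow> (nat \<Rightarrow> int \<Rightarrow> 'e \<Rightarrow> 'e) \<Rightarrow> bool" where
  "adic_resolution_system R \<aa> M E d \<epsilon> \<phi> \<longleftrightarrow>
     (\<forall>n. injective_resolution R (adic_quotient R \<aa> M n) (E n) (d n) (\<epsilon> n)) \<and>
     (\<forall>n. resolution_lift R (adic_quotient R \<aa> M (Suc n))
             (E (Suc n)) (d (Suc n)) (\<epsilon> (Suc n)) (E n) (d n) (\<epsilon> n)
             (adic_projection R \<aa> M n) (\<phi> n))"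

definition formal_local_cohomology ::
    "('r, 'x) ring_scheme \<Rightarrow> 'r set \<Rightarrow> 'r set
       \<Rightarrow> (nat \<Rightarrow> int \<Rightarrow> ('r, 'e) module) \<Rightarrow> (nat \<Rightarrow> int \<Rightarrow> 'e \<Rightarrow> 'e)
       \<Rightarrow> (nat \<Rightarrow> int \<Rightarrow> 'e \<Rightarrow> 'e) \<Rightarrow> int \<Rightarrow> ('r, nat \<Rightarrow> 'e set) module" where
  "formal_local_cohomology R I J E d \<phi> i =
     inverse_limit (\<lambda>n. local_cohomology R I J (E n) (d n) i)
                   (\<lambda>n. local_cohomology_map R I J (E n) (d n) i (\<phi> n))"

end

theory Submission
  imports Defs "HOL-Algebra.Multiplicative_Group"
begin

text \<open>
  If \<open>\<pp>\<close> does not contain \<open>\<aa>\<close>, choose \<open>a \<in> \<aa> - \<pp>\<close>. Multiplication by \<open>a\<^sup>n\<close> is zero on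
  \<open>M/\<aa>\<^sup>nM\<close>, so on an injective resolution it is a null-homotopic lift of the zero map; the
  homotopy consists of linear maps, which preserve torsion, so \<open>a\<^sup>n\<close> annihilates the \<open>n\<close>-th
  module of the inverse system. A linear map out of \<open>R\<^sub>\<pp>\<close> therefore has \<open>n\<close>-th component
  \<open>f(x) = a\<^sup>n f(x/a\<^sup>n) = 0\<close> for every \<open>n\<close>.
\<close>

section \<open>Submodules and linear maps\<close>

text \<open>\<open>CoSupp\<close> compares a Hom set with the singleton of the zero function.
  Excluding a prime therefore takes two facts: every linear map out of the localization vanishes,
  and the zero function is itself a linear map into the limit. The second fact asks that the family
  of zeros be compatible with the transition maps and stable under the operations, which is the
  reason for the lemmas on zero cosets below.

  No single power of \<open>a\<close> has to annihilate the whole limit: exponent n serves level n,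
  and \<open>a^n\<close> is divided out in the localization separately for each n.

  The resolutions and lifts are given data, so the homotopy has to be built from injectivity of the
  given modules. Injectivity is tested only on the type \<open>'r + 'e\<close>, so modules on
  \<open>'e\<close> are first copied into that type.

  Torsion is an elementwise condition: each r in \<open>I^n\<close> has some j in \<open>J\<close>
  with \<open>r x = j x\<close>, where j depends on r and x. Closure under addition is therefore not
  formal; it rests on finding one j that serves two elements at once.\<close>

context module
begin

lemma submoduleI_nonempty:
  assumes "H \<subseteq> carrier M" "H \<noteq> {}"
    and add: "\<And>x y. \<lbrakk>x \<in> H; y \<in> H\<rbrakk> \<Longrightarrow> x \<oplus>\<^bsub>M\<^esub> y \<in> H"
    and smult: "\<And>r x. \<lbrakk>r \<in> carrier R; x \<in> H\<rbrakk> \<Longrightarrow> r \<odot>\<^bsub>M\<^esub> x \<in> H"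
  shows "submodule H R M"
proof (rule submoduleI)
  from assms(2) obtain x where "x \<in> H" by auto
  then show "\<zero>\<^bsub>M\<^esub> \<in> H"
    using smult[of \<zero> x] assms(1) by auto
  show "\<ominus>\<^bsub>M\<^esub> x \<in> H" if "x \<in> H" for x
    using smult[of "\<ominus> \<one>" x] that assms(1) smult_l_minus[of \<one> x] by auto
qed (use assms in auto)

lemma smult_commute:
  "\<lbrakk>r \<in> carrier R; s \<in> carrier R; x \<in> carrier M\<rbrakk> \<Longrightarrow> r \<odot>\<^bsub>M\<^esub> (s \<odot>\<^bsub>M\<^esub> x) = s \<odot>\<^bsub>M\<^esub> (r \<odot>\<^bsub>M\<^esub> x)"
  using smult_assoc1 R.m_comm by metis

lemma submodule_zero: "submodule H R M \<Longrightarrow> \<zero>\<^bsub>M\<^esub> \<in> H"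
  using submodule.axioms(1) subgroup.one_closed by fastforce

lemma submodule_coset_member:
  assumes "submodule H R M" "x \<in> H"
  shows "H +>\<^bsub>M\<^esub> x = H"
  using assms submodule.axioms(1)[OF assms(1)] submoduleE(1)[OF assms(1)]
  by (intro a_coset_join2) auto

text \<open>Cosets are added by \<open>set_add\<close>, so this is what gives 0 + 0 = 0 for the zero
  coset of a quotient.\<close>

lemma submodule_set_add_self:
  assumes "submodule H R M"
  shows "H <+>\<^bsub>M\<^esub> H = H"
proof
  show "H <+>\<^bsub>M\<^esub> H \<subseteq> H"
    using submoduleE(5)[OF assms] by (auto simp: set_add_def')
  show "H \<subseteq> H <+>\<^bsub>M\<^esub> H"
  proof
    fix x assume "x \<in> H"
    moreover have "x = x \<oplus>\<^bsub>M\<^esub> \<zero>\<^bsub>M\<^esub>"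
      using \<open>x \<in> H\<close> submoduleE(1)[OF assms] by auto
    ultimately show "x \<in> H <+>\<^bsub>M\<^esub> H"
      using submodule_zero[OF assms] unfolding set_add_def' by blast
  qed
qed

lemma submodule_span_submodule:
  assumes "S \<subseteq> carrier M"
  shows "submodule (submodule_span R M S) R M"
proof (rule submoduleI_nonempty)
  show "submodule_span R M S \<subseteq> carrier M"
    using assms carrier_is_submodule unfolding submodule_span_def by blast
  have "\<zero>\<^bsub>M\<^esub> \<in> submodule_span R M S"
    unfolding submodule_span_def using submodule_zero by blast
  then show "submodule_span R M S \<noteq> {}" by blast
  show "x \<oplus>\<^bsub>M\<^esub> y \<in> submodule_span R M S"
    if "x \<in> submodule_span R M S" "y \<in> submodule_span R M S" for x y
    using that submoduleE(5) unfolding submodule_span_def by blast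
  show "r \<odot>\<^bsub>M\<^esub> x \<in> submodule_span R M S"
    if "r \<in> carrier R" "x \<in> submodule_span R M S" for r x
    using that submoduleE(4) unfolding submodule_span_def by blast
qed

end

lemma
  assumes "f \<in> mod_Hom R A B"
  shows mod_Hom_closed: "x \<in> carrier A \<Longrightarrow> f x \<in> carrier B"
    and mod_Hom_add: "\<lbrakk>x \<in> carrier A; y \<in> carrier A\<rbrakk> \<Longrightarrow> f (x \<oplus>\<^bsub>A\<^esub> y) = f x \<oplus>\<^bsub>B\<^esub> f y"
    and mod_Hom_smult: "\<lbrakk>r \<in> carrier R; x \<in> carrier A\<rbrakk> \<Longrightarrow> f (r \<odot>\<^bsub>A\<^esub> x) = r \<odot>\<^bsub>B\<^esub> f x"
    and mod_Hom_outside: "x \<notin> carrier A \<Longrightarrow> f x = undefined"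
  using assms by (auto simp: mod_Hom_def)

lemma mod_HomI:
  assumes "\<And>x. x \<in> carrier A \<Longrightarrow> f x \<in> carrier B"
    and "\<And>x y. \<lbrakk>x \<in> carrier A; y \<in> carrier A\<rbrakk> \<Longrightarrow> f (x \<oplus>\<^bsub>A\<^esub> y) = f x \<oplus>\<^bsub>B\<^esub> f y"
    and "\<And>r x. \<lbrakk>r \<in> carrier R; x \<in> carrier A\<rbrakk> \<Longrightarrow> f (r \<odot>\<^bsub>A\<^esub> x) = r \<odot>\<^bsub>B\<^esub> f x"
    and "\<And>x. x \<notin> carrier A \<Longrightarrow> f x = undefined"
  shows "f \<in> mod_Hom R A B"
  using assms by (auto simp: mod_Hom_def)

lemma mod_Hom_zero:
  assumes "module R A" "module R B" "f \<in> mod_Hom R A B"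
  shows "f \<zero>\<^bsub>A\<^esub> = \<zero>\<^bsub>B\<^esub>"
proof -
  interpret A: module R A by fact
  interpret B: module R B by fact
  have "f \<zero>\<^bsub>A\<^esub> = f (\<zero>\<^bsub>R\<^esub> \<odot>\<^bsub>A\<^esub> \<zero>\<^bsub>A\<^esub>)" by simp
  also have "\<dots> = \<zero>\<^bsub>R\<^esub> \<odot>\<^bsub>B\<^esub> f \<zero>\<^bsub>A\<^esub>"
    using mod_Hom_smult[OF assms(3)] by blast
  also have "\<dots> = \<zero>\<^bsub>B\<^esub>"
    using mod_Hom_closed[OF assms(3)] by simp
  finally show ?thesis .
qed

lemma zero_mod_Hom:
  assumes "module R A" "module R B"
  shows "(\<lambda>x\<in>carrier A. \<zero>\<^bsub>B\<^esub>) \<in> mod_Hom R A B"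
proof -
  interpret A: module R A by fact
  interpret B: module R B by fact
  show ?thesis by (rule mod_HomI) auto
qed

lemma mod_Hom_image_submodule:
  assumes "module R A" "module R B" "f \<in> mod_Hom R A B" "submodule H R A"
  shows "submodule (f ` H) R B"
proof -
  interpret A: module R A by fact
  interpret B: module R B by fact
  note H = A.submoduleE[OF assms(4)]
  show ?thesis
  proof (rule B.submoduleI_nonempty)
    show "f ` H \<subseteq> carrier B" using H(1) mod_Hom_closed[OF assms(3)] by blast
    show "f ` H \<noteq> {}" using H(2) by blast
    show "x \<oplus>\<^bsub>B\<^esub> y \<in> f ` H" if xy: "x \<in> f ` H" "y \<in> f ` H" for x y
    proof -
      from xy obtain u v where "u \<in> H" "v \<in> H" "x = f u" "y = f v" by blast
      then have "x \<oplus>\<^bsub>B\<^esub> y = f (u \<oplus>\<^bsub>A\<^esub> v)" "u \<oplus>\<^bsub>A\<^esub> v \<in> H"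
        using mod_Hom_add[OF assms(3), of u v] H(1) H(5)[of u v] by (auto simp: subset_iff)
      then show ?thesis by blast
    qed
    show "r \<odot>\<^bsub>B\<^esub> x \<in> f ` H" if rx: "r \<in> carrier R" "x \<in> f ` H" for r x
    proof -
      from rx obtain u where "u \<in> H" "x = f u" by blast
      then have "r \<odot>\<^bsub>B\<^esub> x = f (r \<odot>\<^bsub>A\<^esub> u)" "r \<odot>\<^bsub>A\<^esub> u \<in> H"
        using mod_Hom_smult[OF assms(3) rx(1)] H(1,4) rx(1) by auto
      then show ?thesis by blast
    qed
  qed
qed

section \<open>Quotient modules\<close>

context
  fixes R :: "('r, 'x) ring_scheme" and E :: "('r, 'm, 'y) module_scheme" and Z B :: "'m set"
  assumes mod: "module R E" and Z: "submodule Z R E" and B: "submodule B R E"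
begin

interpretation E: module R E by (rule mod)

lemma quot_module_zero_closed:
  "\<zero>\<^bsub>quot_module (E\<lparr>carrier := Z\<rparr>) B\<^esub> \<in> carrier (quot_module (E\<lparr>carrier := Z\<rparr>) B)"
proof -
  have "B = B +>\<^bsub>E\<^esub> \<zero>\<^bsub>E\<^esub>"
    using E.submodule_coset_member[OF B E.submodule_zero[OF B]] by simp
  then show ?thesis
    using E.submodule_zero[OF Z]
    by (auto simp: quot_module_def A_RCOSETS_def' a_r_coset_def')
qed

lemma quot_module_zero_add:
  "\<zero>\<^bsub>quot_module (E\<lparr>carrier := Z\<rparr>) B\<^esub> \<oplus>\<^bsub>quot_module (E\<lparr>carrier := Z\<rparr>) B\<^esub>
     \<zero>\<^bsub>quot_module (E\<lparr>carrier := Z\<rparr>) B\<^esub> = \<zero>\<^bsub>quot_module (E\<lparr>carrier := Z\<rparr>) B\<^esub>"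
  using E.submodule_set_add_self[OF B] by (simp add: quot_module_def set_add_def')

lemma quot_module_smult_zero:
  assumes "r \<in> carrier R"
  shows "r \<odot>\<^bsub>quot_module (E\<lparr>carrier := Z\<rparr>) B\<^esub> \<zero>\<^bsub>quot_module (E\<lparr>carrier := Z\<rparr>) B\<^esub>
           = \<zero>\<^bsub>quot_module (E\<lparr>carrier := Z\<rparr>) B\<^esub>"
proof -
  have "B +>\<^bsub>E\<^esub> (r \<odot>\<^bsub>E\<^esub> x) = B" if "x \<in> B" for x
    using E.submodule_coset_member[OF B] E.submoduleE(4)[OF B assms that] by blast
  then show ?thesis
    using E.submoduleE(2)[OF B] by (auto simp: quot_module_def a_r_coset_def')
qed

text \<open>The multiple of a coset is the union of the cosets of \<open>r x\<close> over its
  members \<open>x\<close>. Each member is \<open>b + z\<close>, so \<open>r x\<close> lies in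
  \<open>B\<close> and every coset in that union is \<open>B\<close>.\<close>

lemma quot_module_annihilated:
  assumes r: "r \<in> carrier R" and rZ: "\<And>z. z \<in> Z \<Longrightarrow> r \<odot>\<^bsub>E\<^esub> z \<in> B"
    and C: "C \<in> carrier (quot_module (E\<lparr>carrier := Z\<rparr>) B)"
  shows "r \<odot>\<^bsub>quot_module (E\<lparr>carrier := Z\<rparr>) B\<^esub> C = \<zero>\<^bsub>quot_module (E\<lparr>carrier := Z\<rparr>) B\<^esub>"
proof -
  obtain z where z: "z \<in> Z" "C = B +>\<^bsub>E\<^esub> z"
    using C by (auto simp: quot_module_def A_RCOSETS_def' a_r_coset_def')
  have "r \<odot>\<^bsub>E\<^esub> x \<in> B" if x: "x \<in> C" for x
  proof -
    obtain b where b: "b \<in> B" "x = b \<oplus>\<^bsub>E\<^esub> z"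
      using x z(2) by (auto simp: a_r_coset_def')
    have "r \<odot>\<^bsub>E\<^esub> x = r \<odot>\<^bsub>E\<^esub> b \<oplus>\<^bsub>E\<^esub> r \<odot>\<^bsub>E\<^esub> z"
      using b z(1) r E.submoduleE(1)[OF B] E.submoduleE(1)[OF Z] E.smult_r_distr[of r b z] by blast
    then show ?thesis
      using E.submoduleE(4)[OF B r b(1)] rZ[OF z(1)] E.submoduleE(5)[OF B] by simp
  qed
  then have "B +>\<^bsub>E\<^esub> (r \<odot>\<^bsub>E\<^esub> x) = B" if "x \<in> C" for x
    using that E.submodule_coset_member[OF B] by blast
  \<comment> \<open>Over an empty \<open>C\<close> the union would be the empty set instead of
    \<open>B\<close>.\<close>
  moreover have "C \<noteq> {}"
    using z(2) E.submoduleE(2)[OF B] by (auto simp: a_r_coset_def')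
  ultimately show ?thesis
    by (auto simp: quot_module_def a_r_coset_def')
qed

end

section \<open>Localization\<close>

text \<open>Operations on fractions are unions over all representatives. This reduces computing them
  to independence of the representative.\<close>

lemma UN_pair_constant:
  "\<lbrakk>(a, b) \<in> A; \<And>x y. (x, y) \<in> A \<Longrightarrow> f x y = c\<rbrakk> \<Longrightarrow> (\<Union>(x, y)\<in>A. f x y) = c"
  by auto

context cring
begin

context
  fixes S assumes S: "submonoid S R"
begin

text \<open>With the subtraction removed, proofs about fractions become rearrangements of
  products.\<close>

lemma loc_rel_iff:
  "((r, s), (r', s')) \<in> loc_rel R S \<longleftrightarrow>
     r \<in> carrier R \<and> r' \<in> carrier R \<and> s \<in> S \<and> s' \<in> S \<and>
     (\<exists>u\<in>S. u \<otimes> (r \<otimes> s') = u \<otimes> (r' \<otimes> s))"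
proof -
  have "u \<otimes> (r \<otimes> s' \<ominus> r' \<otimes> s) = \<zero> \<longleftrightarrow> u \<otimes> (r \<otimes> s') = u \<otimes> (r' \<otimes> s)"
    if "r \<in> carrier R" "r' \<in> carrier R" "s \<in> S" "s' \<in> S" "u \<in> S" for u
  proof -
    have "s \<in> carrier R" "s' \<in> carrier R" "u \<in> carrier R"
      using that submonoid.mem_carrier[OF S] by blast+
    then have "u \<otimes> (r \<otimes> s' \<ominus> r' \<otimes> s) = u \<otimes> (r \<otimes> s') \<ominus> u \<otimes> (r' \<otimes> s)"
      using that(1,2) by (simp add: minus_eq r_distr r_minus)
    with \<open>s \<in> carrier R\<close> \<open>s' \<in> carrier R\<close> \<open>u \<in> carrier R\<close> show ?thesis
      using that(1,2) by simp
  qed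
  then show ?thesis unfolding loc_rel_def by auto
qed

lemma loc_rel_equiv: "equiv (carrier R \<times> S) (loc_rel R S)"
proof (rule equivI)
  show "loc_rel R S \<subseteq> (carrier R \<times> S) \<times> (carrier R \<times> S)"
    by (auto simp: loc_rel_def)
  show "refl_on (carrier R \<times> S) (loc_rel R S)"
    using submonoid.one_closed[OF S] by (auto simp: refl_on_def loc_rel_iff)
  show "sym (loc_rel R S)"
    by (rule symI) (force simp: loc_rel_iff)
  show "trans (loc_rel R S)"
  proof (rule transI, clarsimp simp: loc_rel_iff)
    fix r s r' s' r'' s'' u v
    assume *: "s' \<in> S" "u \<in> S" "v \<in> S"
      and r: "r \<in> carrier R" "r' \<in> carrier R" "r'' \<in> carrier R" and "s \<in> S" "s'' \<in> S"
      and uv: "u \<otimes> (r \<otimes> s') = u \<otimes> (r' \<otimes> s)" "v \<otimes> (r' \<otimes> s'') = v \<otimes> (r'' \<otimes> s')"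
    then have c: "u \<in> carrier R" "v \<in> carrier R" "s \<in> carrier R" "s' \<in> carrier R" "s'' \<in> carrier R"
      using submonoid.mem_carrier[OF S] by blast+
    \<comment> \<open>The witness is \<open>u v s'\<close>, where \<open>s'\<close> is the middle
      denominator to be eliminated. Scaling the first relation by \<open>v s''\<close> and the
      second by \<open>u s\<close> makes them meet in \<open>u v r' s s''\<close>.\<close>
    have "(u \<otimes> v \<otimes> s') \<otimes> (r \<otimes> s'') = (v \<otimes> s'') \<otimes> (u \<otimes> (r \<otimes> s'))"
      using r c by (simp add: m_ac)
    also have "\<dots> = (u \<otimes> s) \<otimes> (v \<otimes> (r' \<otimes> s''))"
      unfolding uv(1) using r c by (simp add: m_ac)
    also have "\<dots> = (u \<otimes> v \<otimes> s') \<otimes> (r'' \<otimes> s)"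
      unfolding uv(2) using r c by (simp add: m_ac)
    finally show "\<exists>u\<in>S. u \<otimes> (r \<otimes> s'') = u \<otimes> (r'' \<otimes> s)"
      using * submonoid.m_closed[OF S] by blast
  qed
qed

lemma loc_frac_eqI:
  "((r, s), (r', s')) \<in> loc_rel R S \<Longrightarrow> loc_frac R S r s = loc_frac R S r' s'"
  unfolding loc_frac_def by (rule equiv_class_eq[OF loc_rel_equiv])

lemma loc_frac_closed:
  "\<lbrakk>r \<in> carrier R; s \<in> S\<rbrakk> \<Longrightarrow> loc_frac R S r s \<in> carrier (localization R S)"
  by (auto simp: localization_def loc_frac_def intro: quotientI)

lemma localization_cases:
  assumes "X \<in> carrier (localization R S)"
  obtains r s where "r \<in> carrier R" "s \<in> S" "X = loc_frac R S r s"
  using assms by (auto simp: localization_def loc_frac_def elim!: quotientE)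

lemma loc_frac_self:
  "\<lbrakk>r \<in> carrier R; s \<in> S\<rbrakk> \<Longrightarrow> (r, s) \<in> loc_frac R S r s"
  unfolding loc_frac_def by (rule equiv_class_self[OF loc_rel_equiv]) auto

lemma loc_frac_smult:
  assumes "a \<in> carrier R" "r \<in> carrier R" "s \<in> S"
  shows "a \<odot>\<^bsub>localization R S\<^esub> loc_frac R S r s = loc_frac R S (a \<otimes> r) s"
proof -
  have "loc_frac R S (a \<otimes> r') s' = loc_frac R S (a \<otimes> r) s"
    if "(r', s') \<in> loc_frac R S r s" for r' s'
  proof (rule loc_frac_eqI[symmetric])
    from that obtain u where u: "r' \<in> carrier R" "s' \<in> S" "u \<in> S"
      "u \<otimes> (r \<otimes> s') = u \<otimes> (r' \<otimes> s)"
      by (auto simp: loc_frac_def loc_rel_iff)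
    then have c: "u \<in> carrier R" "s \<in> carrier R" "s' \<in> carrier R"
      using assms(3) submonoid.mem_carrier[OF S] by blast+
    have "u \<otimes> (a \<otimes> r \<otimes> s') = a \<otimes> (u \<otimes> (r \<otimes> s'))"
      using c assms(1,2) by (simp add: m_ac)
    also have "\<dots> = u \<otimes> (a \<otimes> r' \<otimes> s)"
      unfolding u(4) using u(1) c assms(1) by (simp add: m_ac)
    finally show "((a \<otimes> r, s), (a \<otimes> r', s')) \<in> loc_rel R S"
      using u(1-3) assms by (auto simp: loc_rel_iff)
  qed
  then have "(\<Union>(r', s')\<in>loc_frac R S r s. loc_frac R S (a \<otimes> r') s') = loc_frac R S (a \<otimes> r) s"
    by (rule UN_pair_constant[OF loc_frac_self[OF assms(2,3)]])
  then show ?thesis by (simp add: localization_def)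
qed

lemma loc_frac_add:
  assumes "r \<in> carrier R" "s \<in> S" "t \<in> carrier R" "v \<in> S"
  shows "loc_frac R S r s \<oplus>\<^bsub>localization R S\<^esub> loc_frac R S t v
           = loc_frac R S (r \<otimes> v \<oplus> t \<otimes> s) (s \<otimes> v)"
proof -
  have "loc_frac R S (r' \<otimes> v' \<oplus> t' \<otimes> s') (s' \<otimes> v')
      = loc_frac R S (r \<otimes> v \<oplus> t \<otimes> s) (s \<otimes> v)"
    if "(r', s') \<in> loc_frac R S r s" "(t', v') \<in> loc_frac R S t v" for r' s' t' v'
  proof (rule loc_frac_eqI[symmetric])
    from that obtain p q where *: "r' \<in> carrier R" "s' \<in> S" "p \<in> S"
      "t' \<in> carrier R" "v' \<in> S" "q \<in> S"
      and pq: "p \<otimes> (r \<otimes> s') = p \<otimes> (r' \<otimes> s)" "q \<otimes> (t \<otimes> v') = q \<otimes> (t' \<otimes> v)"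
      by (auto simp: loc_frac_def loc_rel_iff)
    then have c: "p \<in> carrier R" "q \<in> carrier R" "s \<in> carrier R" "s' \<in> carrier R"
        "v \<in> carrier R" "v' \<in> carrier R"
      using assms submonoid.mem_carrier[OF S] by blast+
    \<comment> \<open>With the product of both witnesses in front, the first summand can absorb the
      relation of \<open>p\<close> and the second that of \<open>q\<close>.\<close>
    have "(p \<otimes> q) \<otimes> ((r \<otimes> v \<oplus> t \<otimes> s) \<otimes> (s' \<otimes> v')) =
        (q \<otimes> v \<otimes> v') \<otimes> (p \<otimes> (r \<otimes> s')) \<oplus> (p \<otimes> s \<otimes> s') \<otimes> (q \<otimes> (t \<otimes> v'))"
      using c assms(1,3) by (simp add: l_distr r_distr m_ac)
    also have "\<dots> = (p \<otimes> q) \<otimes> ((r' \<otimes> v' \<oplus> t' \<otimes> s') \<otimes> (s \<otimes> v))"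
      unfolding pq using c *(1,4) by (simp add: l_distr r_distr m_ac)
    finally show "((r \<otimes> v \<oplus> t \<otimes> s, s \<otimes> v), (r' \<otimes> v' \<oplus> t' \<otimes> s', s' \<otimes> v')) \<in> loc_rel R S"
      using * assms c submonoid.m_closed[OF S] unfolding loc_rel_iff by blast
  qed
  then have "(\<Union>(r', s')\<in>loc_frac R S r s. \<Union>(t', v')\<in>loc_frac R S t v.
        loc_frac R S (r' \<otimes> v' \<oplus> t' \<otimes> s') (s' \<otimes> v'))
      = loc_frac R S (r \<otimes> v \<oplus> t \<otimes> s) (s \<otimes> v)"
    by (intro UN_pair_constant[OF loc_frac_self[OF assms(1,2)]]
        UN_pair_constant[OF loc_frac_self[OF assms(3,4)]])
  then show ?thesis by (simp add: localization_def)
qed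

lemma localization_smult_closed:
  assumes "a \<in> carrier R" "X \<in> carrier (localization R S)"
  shows "a \<odot>\<^bsub>localization R S\<^esub> X \<in> carrier (localization R S)"
proof -
  obtain r s where "r \<in> carrier R" "s \<in> S" "X = loc_frac R S r s"
    using assms(2) by (rule localization_cases)
  then show ?thesis
    using assms(1) by (simp add: loc_frac_smult loc_frac_closed)
qed

lemma localization_add_closed:
  assumes "X \<in> carrier (localization R S)" "Y \<in> carrier (localization R S)"
  shows "X \<oplus>\<^bsub>localization R S\<^esub> Y \<in> carrier (localization R S)"
proof -
  obtain r s where "r \<in> carrier R" "s \<in> S" "X = loc_frac R S r s"
    using assms(1) by (rule localization_cases)
  moreover obtain t v where "t \<in> carrier R" "v \<in> S" "Y = loc_frac R S t v"
    using assms(2) by (rule localization_cases)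
  ultimately show ?thesis
    using submonoid.mem_carrier[OF S] submonoid.m_closed[OF S]
    by (simp add: loc_frac_add loc_frac_closed)
qed

text \<open>The quotient of \<open>r/s\<close> by \<open>a\<close> is \<open>r/(a s)\<close>, whose
  denominator is again in \<open>S\<close>.\<close>

lemma localization_divisible:
  assumes "a \<in> S" "X \<in> carrier (localization R S)"
  obtains Y where "Y \<in> carrier (localization R S)" "X = a \<odot>\<^bsub>localization R S\<^esub> Y"
proof -
  obtain r s where rs: "r \<in> carrier R" "s \<in> S" "X = loc_frac R S r s"
    using assms(2) by (rule localization_cases)
  have as: "a \<otimes> s \<in> S" using submonoid.m_closed[OF S] assms rs by blast
  have c: "a \<in> carrier R" "s \<in> carrier R"
    using rs(2) assms(1) submonoid.mem_carrier[OF S] by blast+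
  have "\<one> \<otimes> (r \<otimes> (a \<otimes> s)) = \<one> \<otimes> ((a \<otimes> r) \<otimes> s)"
    using c rs(1) by (simp add: m_ac)
  then have "((r, s), (a \<otimes> r, a \<otimes> s)) \<in> loc_rel R S"
    using rs(1,2) as c(1) submonoid.one_closed[OF S] unfolding loc_rel_iff by blast
  then have "X = loc_frac R S (a \<otimes> r) (a \<otimes> s)"
    unfolding rs(3) by (rule loc_frac_eqI)
  also have "\<dots> = a \<odot>\<^bsub>localization R S\<^esub> loc_frac R S r (a \<otimes> s)"
    using rs(1) c(1) as by (simp add: loc_frac_smult)
  finally show thesis
    using that loc_frac_closed[OF rs(1) as] by blast
qed

end

end

lemma (in primeideal) submonoid_compl: "submonoid (carrier R - I) R"
proof
  show "\<one> \<in> carrier R - I"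
    using I_notcarr one_imp_carrier by blast
  show "x \<otimes> y \<in> carrier R - I" if "x \<in> carrier R - I" "y \<in> carrier R - I" for x y
    using that I_prime by blast
qed auto

section \<open>Ideal powers and torsion\<close>

context cring
begin

lemma ideal_power_ideal:
  assumes "ideal I R"
  shows "ideal (ideal_power R I n) R"
proof -
  interpret ideals: comm_monoid "ideals_set R" by (rule ideals_set_is_comm_monoid)
  show ?thesis
    using ideals.nat_pow_closed[of I n] assms by (simp add: ideals_set_def)
qed

lemma ideal_power_add:
  assumes "ideal I R"
  shows "ideal_power R I (m + n) = ideal_prod R (ideal_power R I m) (ideal_power R I n)"
proof -
  interpret ideals: comm_monoid "ideals_set R" by (rule ideals_set_is_comm_monoid)
  show ?thesis
    using ideals.nat_pow_mult[of I m n] assms by (simp add: ideals_set_def)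
qed

lemma pow_in_ideal_power:
  assumes "a \<in> I"
  shows "a [^] n \<in> ideal_power R I (n::nat)"
proof (induction n)
  case 0
  then show ?case by (simp add: ideals_set_def nat_pow_def)
next
  case (Suc n)
  then have "a [^] n \<otimes> a \<in> ideal_prod R (ideal_power R I n) I"
    using assms by (intro ideal_prod.prod)
  then show ?case by (simp add: ideals_set_def nat_pow_def)
qed

end

text \<open>This is the core of closure of torsion under sums. Separate multipliers for
  \<open>x\<close> and \<open>y\<close> say nothing about \<open>x + y\<close>, whereas a common one
  passes to the sum by distributivity.\<close>

lemma (in module) ideal_prod_common_multiplier:
  assumes K: "ideal K R" and L: "ideal L R" and J: "ideal J R"
    and x: "x \<in> carrier M" and y: "y \<in> carrier M"
    and Kx: "\<And>u. u \<in> K \<Longrightarrow> \<exists>j\<in>J. u \<odot>\<^bsub>M\<^esub> x = j \<odot>\<^bsub>M\<^esub> x"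
    and Ly: "\<And>v. v \<in> L \<Longrightarrow> \<exists>j\<in>J. v \<odot>\<^bsub>M\<^esub> y = j \<odot>\<^bsub>M\<^esub> y"
    and "r \<in> ideal_prod R K L"
  shows "\<exists>j\<in>J. r \<odot>\<^bsub>M\<^esub> x = j \<odot>\<^bsub>M\<^esub> x \<and> r \<odot>\<^bsub>M\<^esub> y = j \<odot>\<^bsub>M\<^esub> y"
  using assms(8)
proof (induction rule: ideal_prod.induct)
  case (prod u v)
  obtain j k where j: "j \<in> J" "u \<odot>\<^bsub>M\<^esub> x = j \<odot>\<^bsub>M\<^esub> x" and k: "k \<in> J" "v \<odot>\<^bsub>M\<^esub> y = k \<odot>\<^bsub>M\<^esub> y"
    using Kx[OF prod(1)] Ly[OF prod(2)] by blast
  have c: "u \<in> carrier R" "v \<in> carrier R" "j \<in> carrier R" "k \<in> carrier R"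
    using prod j(1) k(1) ideal.Icarr K L J by metis+
  have kills: "(p \<ominus> q) \<odot>\<^bsub>M\<^esub> z = \<zero>\<^bsub>M\<^esub>"
    if "p \<odot>\<^bsub>M\<^esub> z = q \<odot>\<^bsub>M\<^esub> z" "p \<in> carrier R" "q \<in> carrier R" "z \<in> carrier M" for p q z
    using that by (simp add: R.minus_eq smult_l_distr smult_l_minus M.r_neg)
  \<comment> \<open>\<open>(u - j)(v - k)\<close> annihilates both \<open>x\<close> and \<open>y\<close>, so \<open>uv\<close> acts as \<open>w = uk + jv - jk\<close>.\<close>
  define w where "w = v \<otimes> j \<oplus> k \<otimes> (u \<ominus> j)"
  \<comment> \<open>The defining form of \<open>w\<close> is adapted to \<open>x\<close>, where
    \<open>u - j\<close> acts as zero and \<open>j\<close> as \<open>u\<close>. This form is adapted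
    to \<open>y\<close>, where \<open>v - k\<close> acts as zero and \<open>k\<close> as
    \<open>v\<close>.\<close>
  have w': "w = u \<otimes> k \<oplus> j \<otimes> (v \<ominus> k)"
    unfolding w_def using c by (simp add: R.minus_eq R.r_distr R.r_minus R.a_ac R.m_comm)
  have "w \<in> J"
    unfolding w_def using j(1) k(1) c J
    by (intro additive_subgroup.a_closed ideal.I_l_closed ideal.I_r_closed) (auto intro: ideal.axioms)
  moreover have "(u \<otimes> v) \<odot>\<^bsub>M\<^esub> x = w \<odot>\<^bsub>M\<^esub> x"
  proof -
    have "(u \<otimes> v) \<odot>\<^bsub>M\<^esub> x = v \<odot>\<^bsub>M\<^esub> (u \<odot>\<^bsub>M\<^esub> x)"
      using c x R.m_comm[of u v] by (simp add: smult_assoc1)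
    also have "\<dots> = w \<odot>\<^bsub>M\<^esub> x"
      unfolding w_def using c x kills[OF j(2)] j(2) by (simp add: smult_l_distr smult_assoc1)
    finally show ?thesis .
  qed
  moreover have "(u \<otimes> v) \<odot>\<^bsub>M\<^esub> y = w \<odot>\<^bsub>M\<^esub> y"
    unfolding w' using c y kills[OF k(2)] k(2) by (simp add: smult_l_distr smult_assoc1)
  ultimately show ?case by blast
next
  case (sum p q)
  then obtain j k where *: "j \<in> J" "p \<odot>\<^bsub>M\<^esub> x = j \<odot>\<^bsub>M\<^esub> x" "p \<odot>\<^bsub>M\<^esub> y = j \<odot>\<^bsub>M\<^esub> y"
    "k \<in> J" "q \<odot>\<^bsub>M\<^esub> x = k \<odot>\<^bsub>M\<^esub> x" "q \<odot>\<^bsub>M\<^esub> y = k \<odot>\<^bsub>M\<^esub> y" by blast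
  have c: "p \<in> carrier R" "q \<in> carrier R" "j \<in> carrier R" "k \<in> carrier R"
    using sum(1,2) R.ideal_prod_in_carrier[OF K L] *(1,4) ideal.Icarr[OF J] by auto
  have "j \<oplus> k \<in> J"
    using *(1,4) J by (simp add: additive_subgroup.a_closed ideal.axioms(1))
  then show ?case
    using c * x y by (intro bexI[of _ "j \<oplus> k"]) (auto simp: smult_l_distr)
qed

lemma pair_torsion_carrier_iff:
  "x \<in> carrier (pair_torsion R I J N) \<longleftrightarrow> x \<in> carrier N \<and>
     (\<exists>n\<^sub>0. \<forall>n\<ge>n\<^sub>0. \<forall>r\<in>ideal_power R I n. \<exists>j\<in>J. r \<odot>\<^bsub>N\<^esub> x = j \<odot>\<^bsub>N\<^esub> x)"
  unfolding pair_torsion_def by (simp add: image_subset_iff image_iff)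

lemma pair_torsion_submodule:
  assumes "module R N" "ideal I R" "ideal J R"
  shows "submodule (carrier (pair_torsion R I J N)) R N" (is "submodule ?T R N")
proof -
  interpret N: module R N by fact
  have Ipow: "ideal (ideal_power R I n) R" for n
    using assms(2) by (rule N.ideal_power_ideal)
  show ?thesis
  proof (rule N.submoduleI_nonempty)
    show "?T \<subseteq> carrier N" by (auto simp: pair_torsion_def)
    have "\<exists>j\<in>J. r \<odot>\<^bsub>N\<^esub> \<zero>\<^bsub>N\<^esub> = j \<odot>\<^bsub>N\<^esub> \<zero>\<^bsub>N\<^esub>" if "r \<in> ideal_power R I n" for r n
      using ideal.Icarr[OF Ipow that] ideal.axioms(1)[OF assms(3)] additive_subgroup.zero_closed
      by (intro bexI[of _ "\<zero>\<^bsub>R\<^esub>"]) auto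
    then have "\<zero>\<^bsub>N\<^esub> \<in> ?T" by (auto simp: pair_torsion_carrier_iff)
    then show "?T \<noteq> {}" by blast
  next
    fix x y assume "x \<in> ?T" "y \<in> ?T"
    then obtain m n where x: "x \<in> carrier N" and y: "y \<in> carrier N"
      and m: "\<And>k r. k \<ge> m \<Longrightarrow> r \<in> ideal_power R I k \<Longrightarrow> \<exists>j\<in>J. r \<odot>\<^bsub>N\<^esub> x = j \<odot>\<^bsub>N\<^esub> x"
      and n: "\<And>k r. k \<ge> n \<Longrightarrow> r \<in> ideal_power R I k \<Longrightarrow> \<exists>j\<in>J. r \<odot>\<^bsub>N\<^esub> y = j \<odot>\<^bsub>N\<^esub> y"
      unfolding pair_torsion_carrier_iff by blast
    have "\<exists>j\<in>J. r \<odot>\<^bsub>N\<^esub> (x \<oplus>\<^bsub>N\<^esub> y) = j \<odot>\<^bsub>N\<^esub> (x \<oplus>\<^bsub>N\<^esub> y)"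
      if "k \<ge> m + n" "r \<in> ideal_power R I k" for k r
    proof -
      \<comment> \<open>The threshold \<open>m + n\<close> makes \<open>k - m\<close> at least
        \<open>n\<close>. In \<open>I^k = I^m I^(k - m)\<close> the bound for \<open>x\<close>
        covers the first factor and the bound for \<open>y\<close> the second.\<close>
      have "r \<in> ideal_prod R (ideal_power R I m) (ideal_power R I (k - m))"
        using N.ideal_power_add[OF assms(2), of m "k - m"] that by simp
      moreover have "\<exists>j\<in>J. v \<odot>\<^bsub>N\<^esub> y = j \<odot>\<^bsub>N\<^esub> y" if "v \<in> ideal_power R I (k - m)" for v
        using n[OF _ that] \<open>k \<ge> m + n\<close> by simp
      ultimately obtain j where "j \<in> J" "r \<odot>\<^bsub>N\<^esub> x = j \<odot>\<^bsub>N\<^esub> x" "r \<odot>\<^bsub>N\<^esub> y = j \<odot>\<^bsub>N\<^esub> y"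
        using N.ideal_prod_common_multiplier[OF Ipow Ipow assms(3) x y m[OF order_refl]]
        by blast
      then show ?thesis
        using x y ideal.Icarr[OF Ipow that(2)] ideal.Icarr[OF assms(3)]
        by (intro bexI[of _ j]) (auto simp: N.smult_r_distr)
    qed
    then show "x \<oplus>\<^bsub>N\<^esub> y \<in> ?T"
      using x y unfolding pair_torsion_carrier_iff by blast
  next
    fix c x assume c: "c \<in> carrier R" and "x \<in> ?T"
    then obtain m where x: "x \<in> carrier N"
      and m: "\<And>k r. k \<ge> m \<Longrightarrow> r \<in> ideal_power R I k \<Longrightarrow> \<exists>j\<in>J. r \<odot>\<^bsub>N\<^esub> x = j \<odot>\<^bsub>N\<^esub> x"
      unfolding pair_torsion_carrier_iff by blast
    have comm: "r \<odot>\<^bsub>N\<^esub> (c \<odot>\<^bsub>N\<^esub> x) = c \<odot>\<^bsub>N\<^esub> (r \<odot>\<^bsub>N\<^esub> x)" if "r \<in> carrier R" for r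
      using that c x by (rule N.smult_commute)
    have "\<exists>j\<in>J. r \<odot>\<^bsub>N\<^esub> (c \<odot>\<^bsub>N\<^esub> x) = j \<odot>\<^bsub>N\<^esub> (c \<odot>\<^bsub>N\<^esub> x)"
      if "k \<ge> m" "r \<in> ideal_power R I k" for k r
      using m[OF that] comm ideal.Icarr[OF Ipow that(2)] ideal.Icarr[OF assms(3)] by metis
    then show "c \<odot>\<^bsub>N\<^esub> x \<in> ?T"
      using c x unfolding pair_torsion_carrier_iff by blast
  qed
qed

text \<open>A linear map preserves each relation \<open>r x = j x\<close> with the same
  \<open>j\<close>, so the threshold for \<open>x\<close> also works for its image.\<close>

lemma mod_Hom_pair_torsion:
  assumes "cring R" "ideal I R" "ideal J R" "f \<in> mod_Hom R A B"
    and "x \<in> carrier (pair_torsion R I J A)"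
  shows "f x \<in> carrier (pair_torsion R I J B)"
proof -
  obtain m where x: "x \<in> carrier A"
    and m: "\<And>k r. k \<ge> m \<Longrightarrow> r \<in> ideal_power R I k \<Longrightarrow> \<exists>j\<in>J. r \<odot>\<^bsub>A\<^esub> x = j \<odot>\<^bsub>A\<^esub> x"
    using assms(5) unfolding pair_torsion_carrier_iff by blast
  have "\<exists>j\<in>J. r \<odot>\<^bsub>B\<^esub> f x = j \<odot>\<^bsub>B\<^esub> f x" if "k \<ge> m" "r \<in> ideal_power R I k" for k r
    using m[OF that] mod_Hom_smult[OF assms(4) _ x] ideal.Icarr[OF assms(3)]
      ideal.Icarr[OF cring.ideal_power_ideal[OF assms(1,2)] that(2)] by metis
  then show ?thesis
    using mod_Hom_closed[OF assms(4) x] unfolding pair_torsion_carrier_iff by blast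
qed

section \<open>Null-homotopies on injective resolutions\<close>

text \<open>A copy of a module on the type against which injectivity is tested.\<close>

definition sum_copy :: "('r, 'e) module \<Rightarrow> ('r, 'r + 'e) module" where
  "sum_copy N =
     \<lparr>carrier = Inr ` carrier N, monoid.mult = undefined, one = undefined,
      zero = Inr \<zero>\<^bsub>N\<^esub>, add = (\<lambda>x y. Inr (projr x \<oplus>\<^bsub>N\<^esub> projr y)),
      smult = (\<lambda>r x. Inr (r \<odot>\<^bsub>N\<^esub> projr x))\<rparr>"

lemma sum_copy_module:
  assumes "module R N"
  shows "module R (sum_copy N)"
proof -
  interpret N: module R N by fact
  show ?thesis
  proof (rule moduleI)
    show "cring R" ..
    show "abelian_group (sum_copy N)"
    proof (rule abelian_groupI)
      show "\<exists>y\<in>carrier (sum_copy N). y \<oplus>\<^bsub>sum_copy N\<^esub> x = \<zero>\<^bsub>sum_copy N\<^esub>"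
        if "x \<in> carrier (sum_copy N)" for x
        using that by (auto simp: sum_copy_def N.l_neg intro!: bexI[of _ "\<ominus>\<^bsub>N\<^esub> _"])
    qed (auto simp: sum_copy_def N.a_ac)
  qed (auto simp: sum_copy_def N.smult_l_distr N.smult_r_distr N.smult_assoc1)
qed

text \<open>Both the submodule and the module are moved along \<open>Inr\<close> into the type of
  the test modules. The inclusion is extended there, and the extension is pulled back along
  \<open>Inr\<close>.\<close>

lemma injective_module_extend:
  fixes B E :: "('r, 'e) module"
  assumes E: "injective_module R E" and B: "module R B" and A: "submodule A R B"
    and g: "g \<in> mod_Hom R (B\<lparr>carrier := A\<rparr>) E"
  obtains h where "h \<in> mod_Hom R B E" "\<And>x. x \<in> A \<Longrightarrow> h x = g x"
proof -
  interpret B: module R B by (rule B)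
  note A_sub = B.submoduleE[OF A]
  let ?A = "sum_copy (B\<lparr>carrier := A\<rparr>)"
  have "module R ?A" "module R (sum_copy B)"
    using submodule.submodule_is_module[OF A B] B by (simp_all add: sum_copy_module)
  moreover have "(\<lambda>x\<in>Inr ` A. x) \<in> mod_Hom R ?A (sum_copy B)"
    using A_sub by (intro mod_HomI) (auto simp: sum_copy_def)
  moreover have "inj_on (\<lambda>x\<in>Inr ` A. x) (carrier ?A)"
    by (auto simp: inj_on_def sum_copy_def)
  moreover have "(\<lambda>x\<in>Inr ` A. g (projr x)) \<in> mod_Hom R ?A E"
    using A_sub mod_Hom_closed[OF g] mod_Hom_add[OF g] mod_Hom_smult[OF g]
    by (intro mod_HomI) (auto simp: sum_copy_def)
  ultimately obtain k where k: "k \<in> mod_Hom R (sum_copy B) E"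
    and ext: "\<And>x. x \<in> carrier ?A \<Longrightarrow> k ((\<lambda>x\<in>Inr ` A. x) x) = (\<lambda>x\<in>Inr ` A. g (projr x)) x"
    using E unfolding injective_module_def by meson
  have "(\<lambda>x\<in>carrier B. k (Inr x)) \<in> mod_Hom R B E"
  proof (rule mod_HomI)
    fix x y assume "x \<in> carrier B" "y \<in> carrier B"
    then show "(\<lambda>x\<in>carrier B. k (Inr x)) (x \<oplus>\<^bsub>B\<^esub> y) =
        (\<lambda>x\<in>carrier B. k (Inr x)) x \<oplus>\<^bsub>E\<^esub> (\<lambda>x\<in>carrier B. k (Inr x)) y"
      using mod_Hom_add[OF k, of "Inr x" "Inr y"] by (simp add: sum_copy_def)
  next
    fix r x assume "r \<in> carrier R" "x \<in> carrier B"
    then show "(\<lambda>x\<in>carrier B. k (Inr x)) (r \<odot>\<^bsub>B\<^esub> x) =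
        r \<odot>\<^bsub>E\<^esub> (\<lambda>x\<in>carrier B. k (Inr x)) x"
      using mod_Hom_smult[OF k, of r "Inr x"] by (simp add: sum_copy_def)
  next
    fix x assume "x \<in> carrier B"
    then show "(\<lambda>x\<in>carrier B. k (Inr x)) x \<in> carrier E"
      using mod_Hom_closed[OF k, of "Inr x"] by (simp add: sum_copy_def)
  qed auto
  moreover have "(\<lambda>x\<in>carrier B. k (Inr x)) x = g x" if "x \<in> A" for x
    using that ext[of "Inr x"] A_sub(1) by (auto simp: sum_copy_def)
  ultimately show thesis using that by blast
qed

text \<open>Since \<open>g\<close> vanishes on the kernel of \<open>f\<close>, it descends to the
  image of \<open>f\<close>; injectivity then extends it from that submodule to all of
  \<open>Y\<close>.\<close>

lemma injective_module_factor:
  fixes X Y E :: "('r, 'e) module"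
  assumes E: "injective_module R E" and X: "module R X" and Y: "module R Y"
    and f: "f \<in> mod_Hom R X Y" and g: "g \<in> mod_Hom R X E"
    and ker: "\<And>x. \<lbrakk>x \<in> carrier X; f x = \<zero>\<^bsub>Y\<^esub>\<rbrakk> \<Longrightarrow> g x = \<zero>\<^bsub>E\<^esub>"
  obtains h where "h \<in> mod_Hom R Y E" "\<And>x. x \<in> carrier X \<Longrightarrow> h (f x) = g x"
proof -
  interpret X: module R X by (rule X)
  interpret Y: module R Y by (rule Y)
  interpret E: module R E using E by (simp add: injective_module_def)
  have diff: "k (x \<ominus>\<^bsub>X\<^esub> y) = k x \<ominus>\<^bsub>W\<^esub> k y"
    if "module R W" "k \<in> mod_Hom R X W" "x \<in> carrier X" "y \<in> carrier X" for k x y W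
  proof -
    interpret W: module R W by fact
    have "x \<ominus>\<^bsub>X\<^esub> y = x \<oplus>\<^bsub>X\<^esub> (\<ominus>\<^bsub>R\<^esub> \<one>\<^bsub>R\<^esub>) \<odot>\<^bsub>X\<^esub> y"
      using that by (simp add: X.smult_l_minus X.minus_eq)
    then show ?thesis
      using that mod_Hom_closed[OF that(2)]
      by (simp add: mod_Hom_add[OF that(2)] mod_Hom_smult[OF that(2)] W.smult_l_minus W.minus_eq)
  qed
  have well_def: "g x = g y" if "x \<in> carrier X" "y \<in> carrier X" "f x = f y" for x y
  proof -
    have "f (x \<ominus>\<^bsub>X\<^esub> y) = \<zero>\<^bsub>Y\<^esub>"
      using diff[OF Y f that(1,2)] that(3) mod_Hom_closed[OF f that(2)]
      by (simp add: Y.minus_eq Y.r_neg)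
    then have "g x \<ominus>\<^bsub>E\<^esub> g y = \<zero>\<^bsub>E\<^esub>"
      using ker[of "x \<ominus>\<^bsub>X\<^esub> y"] diff[OF E.module_axioms g that(1,2)] that by simp
    moreover have "g x = (g x \<ominus>\<^bsub>E\<^esub> g y) \<oplus>\<^bsub>E\<^esub> g y"
      using mod_Hom_closed[OF g] that by (simp add: E.minus_eq E.a_assoc E.l_neg)
    ultimately show ?thesis
      using mod_Hom_closed[OF g] that by simp
  qed
  let ?A = "f ` carrier X"
  \<comment> \<open>The descended map picks an arbitrary preimage; \<open>well_def\<close> makes its
    value independent of the choice.\<close>
  define k where "k = (\<lambda>y\<in>?A. g (inv_into (carrier X) f y))"
  have k_eq: "k (f x) = g x" if "x \<in> carrier X" for x
    using that well_def[of "inv_into (carrier X) f (f x)" x]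
    by (simp add: k_def inv_into_into f_inv_into_f)
  have A: "submodule ?A R Y"
    using mod_Hom_image_submodule[OF X Y f X.carrier_is_submodule] .
  have "k \<in> mod_Hom R (Y\<lparr>carrier := ?A\<rparr>) E"
  proof (rule mod_HomI)
    fix y assume "y \<in> carrier (Y\<lparr>carrier := ?A\<rparr>)"
    then show "k y \<in> carrier E"
      using k_eq mod_Hom_closed[OF g] by auto
  next
    fix y z assume "y \<in> carrier (Y\<lparr>carrier := ?A\<rparr>)" "z \<in> carrier (Y\<lparr>carrier := ?A\<rparr>)"
    then obtain u v where uv: "u \<in> carrier X" "v \<in> carrier X" "y = f u" "z = f v" by auto
    then show "k (y \<oplus>\<^bsub>Y\<lparr>carrier := ?A\<rparr>\<^esub> z) = k y \<oplus>\<^bsub>E\<^esub> k z"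
      using k_eq[of "u \<oplus>\<^bsub>X\<^esub> v"] by (simp add: k_eq mod_Hom_add[OF f] mod_Hom_add[OF g])
  next
    fix r y assume "r \<in> carrier R" "y \<in> carrier (Y\<lparr>carrier := ?A\<rparr>)"
    then obtain u where u: "u \<in> carrier X" "y = f u" by auto
    then show "k (r \<odot>\<^bsub>Y\<lparr>carrier := ?A\<rparr>\<^esub> y) = r \<odot>\<^bsub>E\<^esub> k y"
      using k_eq[of "r \<odot>\<^bsub>X\<^esub> u"] \<open>r \<in> carrier R\<close>
      by (simp add: k_eq mod_Hom_smult[OF f] mod_Hom_smult[OF g])
  qed (simp add: k_def)
  then obtain h where "h \<in> mod_Hom R Y E" "\<And>y. y \<in> ?A \<Longrightarrow> h y = k y"
    using injective_module_extend[OF E Y A] by blast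
  then show thesis
    using that k_eq by simp
qed

context
  fixes R :: "('r, 'x) ring_scheme" and N :: "('r, 'm, 'y) module_scheme"
    and E :: "int \<Rightarrow> ('r, 'e) module" and d \<epsilon>
  assumes res: "injective_resolution R N E d \<epsilon>"
begin

lemma resolution_injective: "injective_module R (E i)"
  using res by (simp add: injective_resolution_def)

lemma resolution_module: "module R (E i)"
  using resolution_injective injective_module_def by blast

lemma resolution_differential: "d i \<in> mod_Hom R (E i) (E (i + 1))"
  using res by (simp add: injective_resolution_def)

lemma resolution_differential_pred: "d (i - 1) \<in> mod_Hom R (E (i - 1)) (E i)"
  using resolution_differential[of "i - 1"] by simp

lemma resolution_negative: "\<lbrakk>i < 0; x \<in> carrier (E i)\<rbrakk> \<Longrightarrow> x = \<zero>\<^bsub>E i\<^esub>"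
  using res by (auto simp: injective_resolution_def)

lemma resolution_exact_zero:
  "\<lbrakk>x \<in> carrier (E 0); d 0 x = \<zero>\<^bsub>E 1\<^esub>\<rbrakk> \<Longrightarrow> x \<in> \<epsilon> ` carrier N"
  using res unfolding injective_resolution_def a_kernel_def' by blast

lemma resolution_exact:
  "\<lbrakk>0 \<le> i; x \<in> carrier (E (i + 1)); d (i + 1) x = \<zero>\<^bsub>E (i + 1 + 1)\<^esub>\<rbrakk> \<Longrightarrow> x \<in> d i ` carrier (E i)"
  using res unfolding injective_resolution_def a_kernel_def' by blast

lemma resolution_complex:
  assumes "x \<in> carrier (E i)"
  shows "d (i + 1) (d i x) = \<zero>\<^bsub>E (i + 1 + 1)\<^esub>"
\<comment> \<open>The exactness clause covers only sources of degree at least 0; in negative degrees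
  the source is the zero module.\<close>
proof (cases "i < 0")
  case True
  then have "x = \<zero>\<^bsub>E i\<^esub>"
    using assms resolution_negative by blast
  then show ?thesis
    using mod_Hom_zero[OF resolution_module resolution_module resolution_differential] by simp
next
  case False
  then have "d i ` carrier (E i) = a_kernel (E (i + 1)) (E (i + 1 + 1)) (d (i + 1))"
    using res unfolding injective_resolution_def by simp
  then have "d i x \<in> a_kernel (E (i + 1)) (E (i + 1 + 1)) (d (i + 1))"
    using assms by blast
  then show ?thesis by (simp add: a_kernel_def')
qed

text \<open>Multiplication by \<open>r\<close> lifts the zero map on \<open>N\<close>, so the
  comparison argument for injective resolutions applies. Only a pair of neighbouring homotopy maps
  is asserted in each degree; in the induction, the \<open>t\<close> of one degree becomes the
  \<open>s\<close> of the next.\<close>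

lemma resolution_null_homotopy:
  assumes r: "r \<in> carrier R" and kills: "\<And>x. x \<in> carrier N \<Longrightarrow> r \<odot>\<^bsub>E 0\<^esub> \<epsilon> x = \<zero>\<^bsub>E 0\<^esub>"
    and "0 \<le> i"
  shows "\<exists>s\<in>mod_Hom R (E i) (E (i - 1)). \<exists>t\<in>mod_Hom R (E (i + 1)) (E i).
           \<forall>x\<in>carrier (E i). r \<odot>\<^bsub>E i\<^esub> x = d (i - 1) (s x) \<oplus>\<^bsub>E i\<^esub> t (d i x)"
  using \<open>0 \<le> i\<close>
proof (induction i rule: int_ge_induct)
  case base
  interpret E0: module R "E 0" by (rule resolution_module)
  have g: "(\<lambda>x\<in>carrier (E 0). r \<odot>\<^bsub>E 0\<^esub> x) \<in> mod_Hom R (E 0) (E 0)"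
    using r E0.smult_commute by (intro mod_HomI) (auto simp: E0.smult_r_distr)
  have ker: "(\<lambda>x\<in>carrier (E 0). r \<odot>\<^bsub>E 0\<^esub> x) x = \<zero>\<^bsub>E 0\<^esub>"
    if "x \<in> carrier (E 0)" "d 0 x = \<zero>\<^bsub>E (0 + 1)\<^esub>" for x
    using resolution_exact_zero[of x] that kills by auto
  obtain t where t: "t \<in> mod_Hom R (E (0 + 1)) (E 0)"
    "\<And>x. x \<in> carrier (E 0) \<Longrightarrow> t (d 0 x) = (\<lambda>x\<in>carrier (E 0). r \<odot>\<^bsub>E 0\<^esub> x) x"
    by (rule injective_module_factor[OF resolution_injective resolution_module resolution_module
        resolution_differential g ker]) blast+
  \<comment> \<open>Degree -1 of the resolution is the zero module, so the homotopy starts with the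
    zero map.\<close>
  define s where "s = (\<lambda>x\<in>carrier (E 0). \<zero>\<^bsub>E (0 - 1)\<^esub>)"
  have s: "s \<in> mod_Hom R (E 0) (E (0 - 1))"
    unfolding s_def by (intro zero_mod_Hom resolution_module)
  have "r \<odot>\<^bsub>E 0\<^esub> x = d (0 - 1) (s x) \<oplus>\<^bsub>E 0\<^esub> t (d 0 x)" if x: "x \<in> carrier (E 0)" for x
  proof -
    have "d (0 - 1) (s x) = \<zero>\<^bsub>E 0\<^esub>"
      using mod_Hom_zero[OF resolution_module resolution_module resolution_differential_pred[of 0]] x
      by (simp add: s_def)
    then show ?thesis
      using t(2)[OF x] x r by simp
  qed
  then show ?case using s t(1) by blast
next
  case (step i)
  then obtain s t where s: "s \<in> mod_Hom R (E i) (E (i - 1))" and t: "t \<in> mod_Hom R (E (i + 1)) (E i)"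
    and st: "\<And>x. x \<in> carrier (E i) \<Longrightarrow> r \<odot>\<^bsub>E i\<^esub> x = d (i - 1) (s x) \<oplus>\<^bsub>E i\<^esub> t (d i x)"
    by blast
  interpret E: module R "E i" by (rule resolution_module)
  interpret E': module R "E (i + 1)" by (rule resolution_module)
  note di = resolution_differential[of i]
  note cl = mod_Hom_closed[OF t] mod_Hom_closed[OF di]
  \<comment> \<open>What remains of multiplication by \<open>r\<close> after the known half
    \<open>d t\<close> is removed. On a boundary \<open>x = d y\<close>, the homotopy identity for
    \<open>y\<close> and \<open>d d = 0\<close> give \<open>r x = d (t x)\<close>. Hence
    \<open>g\<close> vanishes on the kernel of the next differential and factors through it.\<close>
  define g where "g = (\<lambda>x\<in>carrier (E (i + 1)). r \<odot>\<^bsub>E (i + 1)\<^esub> x \<ominus>\<^bsub>E (i + 1)\<^esub> d i (t x))"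
  have g: "g \<in> mod_Hom R (E (i + 1)) (E (i + 1))"
  proof (rule mod_HomI)
    fix x y assume "x \<in> carrier (E (i + 1))" "y \<in> carrier (E (i + 1))"
    then show "g (x \<oplus>\<^bsub>E (i + 1)\<^esub> y) = g x \<oplus>\<^bsub>E (i + 1)\<^esub> g y"
      using r cl by (simp add: g_def E'.smult_r_distr mod_Hom_add[OF t] mod_Hom_add[OF di]
          E'.minus_eq E'.minus_add E'.a_ac)
  next
    fix c x assume "c \<in> carrier R" "x \<in> carrier (E (i + 1))"
    moreover from this have "r \<odot>\<^bsub>E (i + 1)\<^esub> (c \<odot>\<^bsub>E (i + 1)\<^esub> x) = c \<odot>\<^bsub>E (i + 1)\<^esub> (r \<odot>\<^bsub>E (i + 1)\<^esub> x)"
      using r E'.smult_commute by blast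
    ultimately show "g (c \<odot>\<^bsub>E (i + 1)\<^esub> x) = c \<odot>\<^bsub>E (i + 1)\<^esub> g x"
      using r cl by (simp add: g_def E'.smult_r_distr mod_Hom_smult[OF t] mod_Hom_smult[OF di]
          E'.minus_eq E'.smult_r_minus)
  qed (use r cl in \<open>auto simp: g_def\<close>)
  have ker: "g x = \<zero>\<^bsub>E (i + 1)\<^esub>"
    if x: "x \<in> carrier (E (i + 1))" "d (i + 1) x = \<zero>\<^bsub>E (i + 1 + 1)\<^esub>" for x
  proof -
    obtain y where y: "y \<in> carrier (E i)" "x = d i y"
      using resolution_exact[OF step(1) x] by blast
    have s_y: "s y \<in> carrier (E (i - 1))"
      using mod_Hom_closed[OF s y(1)] .
    have "r \<odot>\<^bsub>E (i + 1)\<^esub> x = d i (r \<odot>\<^bsub>E i\<^esub> y)"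
      using mod_Hom_smult[OF di r y(1)] y(2) by simp
    also have "\<dots> = d i (d (i - 1) (s y)) \<oplus>\<^bsub>E (i + 1)\<^esub> d i (t x)"
      unfolding st[OF y(1)] y(2)
      using y(1) cl mod_Hom_closed[OF resolution_differential_pred s_y] by (simp add: mod_Hom_add[OF di])
    also have "\<dots> = d i (t x)"
      using resolution_complex[OF s_y] cl x by simp
    finally show ?thesis
      using x cl by (simp add: g_def E'.minus_eq E'.r_neg)
  qed
  obtain u where u: "u \<in> mod_Hom R (E (i + 1 + 1)) (E (i + 1))"
    "\<And>x. x \<in> carrier (E (i + 1)) \<Longrightarrow> u (d (i + 1) x) = g x"
    by (rule injective_module_factor[OF resolution_injective resolution_module resolution_module
        resolution_differential g ker]) blast+
  have "r \<odot>\<^bsub>E (i + 1)\<^esub> x = d i (t x) \<oplus>\<^bsub>E (i + 1)\<^esub> u (d (i + 1) x)"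
    if x: "x \<in> carrier (E (i + 1))" for x
  proof -
    have "g x \<oplus>\<^bsub>E (i + 1)\<^esub> d i (t x) = r \<odot>\<^bsub>E (i + 1)\<^esub> x"
      using x r cl by (simp add: g_def E'.minus_eq E'.a_assoc E'.l_neg)
    then show ?thesis
      using u(2)[OF x] x cl mod_Hom_closed[OF g x] by (simp add: E'.a_comm)
  qed
  \<comment> \<open>The old \<open>t\<close> is the new \<open>s\<close>; the rewriting identifies
    its target index \<open>i + 1 - 1\<close> with \<open>i\<close>.\<close>
  then show ?case
    using t u(1) unfolding add_diff_cancel_right' by blast
qed

end
section \<open>Annihilation of local cohomology\<close>

lemma ideal_times_module_submodule:
  assumes "module R M" "ideal I R"
  shows "submodule (ideal_times_module R I M) R M"
proof -
  interpret M: module R M by fact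
  show ?thesis
    unfolding ideal_times_module_def using ideal.Icarr[OF assms(2)]
    by (intro M.submodule_span_submodule) auto
qed

text \<open>Multiplication by \<open>r\<close> sends all of \<open>M\<close> into the submodule that
  is divided out. The claim is made about the image under \<open>f\<close> because, with the
  augmentation for \<open>f\<close>, it is the assumption under which the null-homotopy
  exists.\<close>

lemma adic_quotient_annihilated:
  assumes M: "module R M" and I: "ideal I R" and r: "r \<in> ideal_power R I n"
    and N: "module R N" and f: "f \<in> mod_Hom R (adic_quotient R I M n) N"
    and C: "C \<in> carrier (adic_quotient R I M n)"
  shows "r \<odot>\<^bsub>N\<^esub> f C = \<zero>\<^bsub>N\<^esub>"
proof -
  interpret M: module R M by fact
  interpret N: module R N by fact
  define K where "K = ideal_times_module R (ideal_power R I n) M"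
  define Q where "Q = adic_quotient R I M n"
  have Q_eq: "Q = quot_module (M\<lparr>carrier := carrier M\<rparr>) K"
    by (simp add: Q_def adic_quotient_def K_def)
  have Ipow: "ideal (ideal_power R I n) R"
    using I by (rule M.ideal_power_ideal)
  have r': "r \<in> carrier R" using ideal.Icarr[OF Ipow r] .
  have K: "submodule K R M"
    unfolding K_def using M Ipow by (rule ideal_times_module_submodule)
  note quot = M M.carrier_is_submodule K
  have "r \<odot>\<^bsub>M\<^esub> x \<in> K" if "x \<in> carrier M" for x
    using r that unfolding K_def ideal_times_module_def submodule_span_def by blast
  then have "r \<odot>\<^bsub>Q\<^esub> C = \<zero>\<^bsub>Q\<^esub>"
    using quot_module_annihilated[OF quot r'] C unfolding Q_eq[symmetric] Q_def[symmetric] by blast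
  then have "r \<odot>\<^bsub>N\<^esub> f C = f \<zero>\<^bsub>Q\<^esub>"
    using mod_Hom_smult[OF f r' C] unfolding Q_def by simp
  moreover have z: "\<zero>\<^bsub>Q\<^esub> \<in> carrier Q" "\<zero>\<^bsub>Q\<^esub> \<oplus>\<^bsub>Q\<^esub> \<zero>\<^bsub>Q\<^esub> = \<zero>\<^bsub>Q\<^esub>"
    unfolding Q_eq using quot_module_zero_closed[OF quot] quot_module_zero_add[OF quot] by blast+
  \<comment> \<open>The image of the zero coset is additively idempotent, and cancellation in
    \<open>N\<close> makes it zero.\<close>
  then have "f \<zero>\<^bsub>Q\<^esub> \<oplus>\<^bsub>N\<^esub> f \<zero>\<^bsub>Q\<^esub> = f \<zero>\<^bsub>Q\<^esub>" "f \<zero>\<^bsub>Q\<^esub> \<in> carrier N"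
    using mod_Hom_add[OF f, of "\<zero>\<^bsub>Q\<^esub>" "\<zero>\<^bsub>Q\<^esub>"] mod_Hom_closed[OF f, of "\<zero>\<^bsub>Q\<^esub>"]
    unfolding Q_def by simp_all
  then have "f \<zero>\<^bsub>Q\<^esub> = \<zero>\<^bsub>N\<^esub>" by simp
  ultimately show ?thesis by simp
qed

context
  fixes R :: "('r, 'x) ring_scheme" and N :: "('r, 'm, 'y) module_scheme"
    and E :: "int \<Rightarrow> ('r, 'e) module" and d \<epsilon> I J and i :: int
  assumes res: "injective_resolution R N E d \<epsilon>" and I: "ideal I R" and J: "ideal J R"
begin

abbreviation (input) "torsion_complex \<equiv> \<lambda>k. pair_torsion R I J (E k)"
abbreviation (input) "torsion_cocycles \<equiv> carrier (cocycles torsion_complex d i)"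
abbreviation (input) "torsion_coboundaries \<equiv> coboundaries torsion_complex d i"

lemma torsion_cocycles_iff:
  "x \<in> torsion_cocycles \<longleftrightarrow> x \<in> carrier (torsion_complex i) \<and> d i x = \<zero>\<^bsub>E (i + 1)\<^esub>"
  by (simp add: cocycles_def a_kernel_def' pair_torsion_def)

text \<open>Passing to torsion and to cocycles changes only the carrier, so the result is a quotient
  taken inside \<open>E i\<close>, in the form the quotient lemmas expect.\<close>

lemma local_cohomology_eq:
  "local_cohomology R I J E d i
     = quot_module ((E i)\<lparr>carrier := torsion_cocycles\<rparr>) torsion_coboundaries"
  by (simp add: local_cohomology_def cohomology_def cocycles_def pair_torsion_def)

lemma torsion_cocycles_submodule: "submodule torsion_cocycles R (E i)"
proof -
  interpret E: module R "E i" by (rule resolution_module[OF res])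
  interpret E': module R "E (i + 1)" by (rule resolution_module[OF res])
  have T: "submodule (carrier (torsion_complex i)) R (E i)"
    using E.module_axioms I J by (rule pair_torsion_submodule)
  note T_sub = E.submoduleE[OF T]
  note di = resolution_differential[OF res, of i]
  show ?thesis
  proof (rule E.submoduleI_nonempty)
    have "\<zero>\<^bsub>E i\<^esub> \<in> torsion_cocycles"
      using E.submodule_zero[OF T] mod_Hom_zero[OF E.module_axioms E'.module_axioms di]
      by (simp add: torsion_cocycles_iff)
    then show "torsion_cocycles \<noteq> {}" by blast
    show "x \<oplus>\<^bsub>E i\<^esub> y \<in> torsion_cocycles" if "x \<in> torsion_cocycles" "y \<in> torsion_cocycles" for x y
      using that T_sub(1,5) mod_Hom_add[OF di, of x y] by (auto simp: torsion_cocycles_iff)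
    show "r \<odot>\<^bsub>E i\<^esub> x \<in> torsion_cocycles" if "r \<in> carrier R" "x \<in> torsion_cocycles" for r x
      using that T_sub(1,4) mod_Hom_smult[OF di, of r x] by (auto simp: torsion_cocycles_iff)
    show "torsion_cocycles \<subseteq> carrier (E i)"
      using T_sub(1) by (auto simp: torsion_cocycles_iff)
  qed
qed

lemma torsion_coboundaries_submodule: "submodule torsion_coboundaries R (E i)"
  unfolding coboundaries_def
  by (rule mod_Hom_image_submodule[OF resolution_module[OF res] resolution_module[OF res]
      resolution_differential_pred[OF res] pair_torsion_submodule[OF resolution_module[OF res] I J]])

lemmas local_cohomology_zero =
  quot_module_zero_closed[OF resolution_module[OF res] torsion_cocycles_submodule
    torsion_coboundaries_submodule, folded local_cohomology_eq]
  quot_module_zero_add[OF resolution_module[OF res] torsion_cocycles_submodule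
    torsion_coboundaries_submodule, folded local_cohomology_eq]
  quot_module_smult_zero[OF resolution_module[OF res] torsion_cocycles_submodule
    torsion_coboundaries_submodule, folded local_cohomology_eq]

lemma local_cohomology_annihilated:
  assumes r: "r \<in> carrier R" and kills: "\<And>x. x \<in> carrier N \<Longrightarrow> r \<odot>\<^bsub>E 0\<^esub> \<epsilon> x = \<zero>\<^bsub>E 0\<^esub>"
    and "C \<in> carrier (local_cohomology R I J E d i)"
  shows "r \<odot>\<^bsub>local_cohomology R I J E d i\<^esub> C = \<zero>\<^bsub>local_cohomology R I J E d i\<^esub>"
proof -
  interpret E: module R "E i" by (rule resolution_module[OF res])
  have "r \<odot>\<^bsub>E i\<^esub> z \<in> torsion_coboundaries" if "z \<in> torsion_cocycles" for z
  \<comment> \<open>The homotopy is available from degree 0 on; below that the resolution is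
    zero.\<close>
  proof (cases "i < 0")
    case True
    have "z = \<zero>\<^bsub>E i\<^esub>"
      using that E.submoduleE(1)[OF torsion_cocycles_submodule] resolution_negative[OF res True]
      by blast
    then show ?thesis
      using r E.submodule_zero[OF torsion_coboundaries_submodule] by simp
  next
    case False
    then obtain s t where s: "s \<in> mod_Hom R (E i) (E (i - 1))" and t: "t \<in> mod_Hom R (E (i + 1)) (E i)"
      and st: "\<And>x. x \<in> carrier (E i) \<Longrightarrow> r \<odot>\<^bsub>E i\<^esub> x = d (i - 1) (s x) \<oplus>\<^bsub>E i\<^esub> t (d i x)"
      using resolution_null_homotopy[OF res r kills, of i] by (meson not_less)
    have z: "z \<in> carrier (torsion_complex i)" "d i z = \<zero>\<^bsub>E (i + 1)\<^esub>" "z \<in> carrier (E i)"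
      using that by (auto simp: torsion_cocycles_iff pair_torsion_carrier_iff)
    have "t \<zero>\<^bsub>E (i + 1)\<^esub> = \<zero>\<^bsub>E i\<^esub>"
      using mod_Hom_zero[OF resolution_module[OF res] E.module_axioms t] .
    then have "r \<odot>\<^bsub>E i\<^esub> z = d (i - 1) (s z)"
      using st[OF z(3)] z(2) mod_Hom_closed[OF resolution_differential_pred[OF res]
          mod_Hom_closed[OF s z(3)]] by simp
    \<comment> \<open>The preimage must itself be torsion: this makes \<open>r z\<close> a
      coboundary of the torsion complex and not merely of the resolution.\<close>
    moreover have "s z \<in> carrier (torsion_complex (i - 1))"
      using mod_Hom_pair_torsion[OF E.is_cring I J s z(1)] .
    ultimately show ?thesis by (simp add: coboundaries_def)
  qed
  then show ?thesis
    using quot_module_annihilated[OF E.module_axioms torsion_cocycles_submodule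
        torsion_coboundaries_submodule r] assms(3)
    unfolding local_cohomology_eq by blast
qed

end

text \<open>The zero coset is the set of coboundaries. A chain map commutes with the differentials
  and preserves torsion, so it sends coboundaries to coboundaries. This places the family of zeros
  in the inverse limit.\<close>

lemma local_cohomology_map_zero:
  assumes res: "injective_resolution R N E d \<epsilon>" and res': "injective_resolution R N' E' d' \<epsilon>'"
    and lift: "resolution_lift R N E d \<epsilon> E' d' \<epsilon>' f \<phi>"
    and I: "ideal I R" and J: "ideal J R"
  shows "local_cohomology_map R I J E' d' i \<phi> \<zero>\<^bsub>local_cohomology R I J E d i\<^esub>
           = \<zero>\<^bsub>local_cohomology R I J E' d' i\<^esub>"
proof -
  interpret E: module R "E i" by (rule resolution_module[OF res])
  interpret E': module R "E' i" by (rule resolution_module[OF res'])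
  let ?B = "coboundaries (\<lambda>k. pair_torsion R I J (E k)) d i"
  let ?B' = "coboundaries (\<lambda>k. pair_torsion R I J (E' k)) d' i"
  have \<phi>: "\<phi> (i - 1) \<in> mod_Hom R (E (i - 1)) (E' (i - 1))"
    using lift by (simp add: resolution_lift_def)
  have comm: "\<phi> i (d (i - 1) y) = d' (i - 1) (\<phi> (i - 1) y)" if "y \<in> carrier (E (i - 1))" for y
  proof -
    have "\<phi> (i - 1 + 1) (d (i - 1) y) = d' (i - 1) (\<phi> (i - 1) y)"
      using lift that unfolding resolution_lift_def by blast
    then show ?thesis by simp
  qed
  have "\<phi> i x \<in> ?B'" if "x \<in> ?B" for x
    using that comm mod_Hom_pair_torsion[OF E.is_cring I J \<phi>]
    by (auto simp: coboundaries_def pair_torsion_carrier_iff[of _ R I J "E (i - 1)"])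
  then have "?B' +>\<^bsub>E' i\<^esub> \<phi> i x = ?B'" if "x \<in> ?B" for x
    using that E'.submodule_coset_member[OF torsion_coboundaries_submodule[OF res' I J]] by blast
  moreover have "?B \<noteq> {}"
    using E.submoduleE(2)[OF torsion_coboundaries_submodule[OF res I J]] .
  ultimately show ?thesis
    by (auto simp: local_cohomology_map_def quot_map_def local_cohomology_def cohomology_def
        quot_module_def cocycles_def pair_torsion_def a_r_coset_def')
qed

section \<open>Cosupport of an inverse limit\<close>

text \<open>The facts about zeros and \<open>t_zero\<close> make the zero function a linear map into
  the limit; \<open>kills\<close> makes it the only one.\<close>

lemma not_CoSupp_inverse_limit:
  fixes H :: "nat \<Rightarrow> ('r, 'm, 'y) module_scheme"
  assumes "cring R" "a \<in> carrier R" "a \<notin> \<pp>"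
    and zero_closed: "\<And>n. \<zero>\<^bsub>H n\<^esub> \<in> carrier (H n)"
    and zero_add: "\<And>n. \<zero>\<^bsub>H n\<^esub> \<oplus>\<^bsub>H n\<^esub> \<zero>\<^bsub>H n\<^esub> = \<zero>\<^bsub>H n\<^esub>"
    and smult_zero: "\<And>n r. r \<in> carrier R \<Longrightarrow> r \<odot>\<^bsub>H n\<^esub> \<zero>\<^bsub>H n\<^esub> = \<zero>\<^bsub>H n\<^esub>"
    and t_zero: "\<And>n. t n \<zero>\<^bsub>H (Suc n)\<^esub> = \<zero>\<^bsub>H n\<^esub>"
    and kills: "\<And>n x. x \<in> carrier (H n) \<Longrightarrow> (a [^]\<^bsub>R\<^esub> n) \<odot>\<^bsub>H n\<^esub> x = \<zero>\<^bsub>H n\<^esub>"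
  shows "\<pp> \<notin> CoSupp R (inverse_limit H t)"
proof
  assume "\<pp> \<in> CoSupp R (inverse_limit H t)"
  define L where "L = localization R (carrier R - \<pp>)"
  define F where "F = inverse_limit H t"
  have prime: "primeideal \<pp> R" and ne: "mod_Hom R L F \<noteq> {\<lambda>x\<in>carrier L. \<zero>\<^bsub>F\<^esub>}"
    using \<open>\<pp> \<in> CoSupp R (inverse_limit H t)\<close> by (auto simp: CoSupp_def Spec_def L_def F_def)
  interpret R: cring R by fact
  have S: "submonoid (carrier R - \<pp>) R"
    using prime by (rule primeideal.submonoid_compl)
  have aS: "a [^]\<^bsub>R\<^esub> n \<in> carrier R - \<pp>" for n :: nat
    using assms(2,3) S submonoid.m_closed[OF S] submonoid.one_closed[OF S] by (induction n) auto
  have "f = (\<lambda>x\<in>carrier L. \<zero>\<^bsub>F\<^esub>)" if f: "f \<in> mod_Hom R L F" for f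
  proof
    fix x
    show "f x = (\<lambda>x\<in>carrier L. \<zero>\<^bsub>F\<^esub>) x"
    proof (cases "x \<in> carrier L")
      case True
      \<comment> \<open>The quotient \<open>y\<close> of \<open>x\<close> by \<open>a^n\<close> is
        chosen anew for each component, which is why the exponent may grow with
        \<open>n\<close>.\<close>
      have "f x n = \<zero>\<^bsub>H n\<^esub>" for n
      proof -
        obtain y where y: "y \<in> carrier L" "x = (a [^]\<^bsub>R\<^esub> n) \<odot>\<^bsub>L\<^esub> y"
          using R.localization_divisible[OF S aS] True unfolding L_def by blast
        have "f x = (a [^]\<^bsub>R\<^esub> n) \<odot>\<^bsub>F\<^esub> f y"
          using mod_Hom_smult[OF f _ y(1)] assms(2) y(2) by simp
        then show ?thesis
          using mod_Hom_closed[OF f y(1)] kills by (simp add: F_def inverse_limit_def)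
      qed
      then show ?thesis using True by (auto simp: F_def inverse_limit_def)
    qed (simp add: mod_Hom_outside[OF f])
  qed
  \<comment> \<open>An empty Hom set would also differ from the singleton, so membership of the zero
    function has to be shown.\<close>
  moreover have "(\<lambda>x\<in>carrier L. \<zero>\<^bsub>F\<^esub>) \<in> mod_Hom R L F"
    using R.localization_add_closed[OF S] R.localization_smult_closed[OF S]
      zero_closed zero_add smult_zero t_zero
    by (intro mod_HomI) (auto simp: L_def F_def inverse_limit_def)
  ultimately show False using ne by blast
qed

theorem proposition5p3:
  fixes R :: "('r, 'x) ring_scheme"
    and M :: "('r, 'm, 'y) module_scheme"
    and \<mm> \<aa> J :: "'r set"
    and E :: "nat \<Rightarrow> int \<Rightarrow> ('r, 'e) module"
    and d :: "nat \<Rightarrow> int \<Rightarrow> 'e \<Rightarrow> 'e"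
    and \<epsilon> :: "nat \<Rightarrow> 'm set \<Rightarrow> 'e"
    and \<phi> :: "nat \<Rightarrow> int \<Rightarrow> 'e \<Rightarrow> 'e"
    and i :: int
  assumes "local_ring R \<mm>"
    and "noetherian_ring R"
    and "ideal \<aa> R"
    and "ideal J R"
    and "module R M"
    and "finitely_generated_module R M"
    and "carrier M \<noteq> {\<zero>\<^bsub>M\<^esub>}"
    and "adic_resolution_system R \<aa> M E d \<epsilon> \<phi>"
  shows "CoSupp R (formal_local_cohomology R \<mm> J E d \<phi> i) \<subseteq> V R \<aa>"
proof
  fix \<pp>
  assume \<pp>: "\<pp> \<in> CoSupp R (formal_local_cohomology R \<mm> J E d \<phi> i)"
  interpret M: module R M by fact
  have \<mm>: "ideal \<mm> R"
    using assms(1) maximalideal.axioms(1) unfolding local_ring_def by blast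
  have res: "injective_resolution R (adic_quotient R \<aa> M n) (E n) (d n) (\<epsilon> n)" for n
    using assms(8) by (simp add: adic_resolution_system_def)
  have lift: "resolution_lift R (adic_quotient R \<aa> M (Suc n)) (E (Suc n)) (d (Suc n))
      (\<epsilon> (Suc n)) (E n) (d n) (\<epsilon> n) (adic_projection R \<aa> M n) (\<phi> n)" for n
    using assms(8) by (simp add: adic_resolution_system_def)
  have "\<aa> \<subseteq> \<pp>"
  proof (rule ccontr)
    assume "\<not> \<aa> \<subseteq> \<pp>"
    then obtain a where a: "a \<in> \<aa>" "a \<notin> \<pp>" by blast
    have "a \<in> carrier R" using ideal.Icarr[OF assms(3) a(1)] .
    have \<epsilon>: "\<epsilon> n \<in> mod_Hom R (adic_quotient R \<aa> M n) (E n 0)" for n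
      using res by (simp add: injective_resolution_def)
    \<comment> \<open>The exponent equals the level because \<open>a^n\<close> lies in the n-th
      power of the ideal. At \<open>n = 0\<close> that power is the whole ring, and 1 kills the zero
      module \<open>M/RM\<close>.\<close>
    have "(a [^]\<^bsub>R\<^esub> n) \<odot>\<^bsub>E n 0\<^esub> \<epsilon> n x = \<zero>\<^bsub>E n 0\<^esub>"
      if "x \<in> carrier (adic_quotient R \<aa> M n)" for n x
      using adic_quotient_annihilated[OF assms(5,3) M.pow_in_ideal_power[OF a(1)]
          resolution_module[OF res] \<epsilon> that] .
    then have "(a [^]\<^bsub>R\<^esub> n) \<odot>\<^bsub>local_cohomology R \<mm> J (E n) (d n) i\<^esub> C
        = \<zero>\<^bsub>local_cohomology R \<mm> J (E n) (d n) i\<^esub>"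
      if "C \<in> carrier (local_cohomology R \<mm> J (E n) (d n) i)" for n C
      using local_cohomology_annihilated[OF res \<mm> assms(4) _ _ that] \<open>a \<in> carrier R\<close> by blast
    then have "\<pp> \<notin> CoSupp R (formal_local_cohomology R \<mm> J E d \<phi> i)"
      unfolding formal_local_cohomology_def
      using local_cohomology_zero[OF res \<mm> assms(4)]
        local_cohomology_map_zero[OF res res lift \<mm> assms(4)]
      by (intro not_CoSupp_inverse_limit[OF M.is_cring \<open>a \<in> carrier R\<close> a(2)])
    then show False using \<pp> by blast
  qed
  then show "\<pp> \<in> V R \<aa>"
    using \<pp> by (simp add: V_def CoSupp_def)
qed

end
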